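(* Let $\underline{\mathbf d}=(a_1,\dots,a_r,b_1,\dots,b_s;n)$ be a dimension vector such that $\sum_{i=1}^r a_i=n-k<n$ and $\sum_{j=1}^s (n-b_j)\le n-k$. Then $\underline{\mathbf d}$ is dense if $\underline{\mathbf d}'=(a_1,\dots,a_r,b_1-k,\dots,b_s-k;n-k)$ is dense.
   Context: Work over an algebraically closed field of arbitrary characteristic. $Gr(d;n)$ is the Grassmannian of $d$-dimensional linear subspaces of a fixed $n$-dimensional vector space. A dimension vector $(d_1,\dots,d_m;n)$ consists of integers with $1\le d_i\le n-1$; it is dense if the diagonal action of $\mathbb{P}GL(n)$ on $\prod_{i} Gr(d_i;n)$ has a Zariski dense orbit. In the vector $\underline{\mathbf d}'$, entries equal to $0$ or to the ambient dimension are allowed; the corresponding Grassmannian is a point, so such entries can be dropped. Here $r,s\ge 1$. *)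

theory Defs
  imports
    "HOL-Analysis.Abstract_Topology"
    "HOL-Algebra.Group_Action"
    "HOL-Library.Poly_Mapping"
    "HOL-Computational_Algebra.Polynomial"
    "Jordan_Normal_Form.DL_Submatrix"
    "Jordan_Normal_Form.VS_Connect"
begin

section \<open>Grassmannians and the action of the projective linear group\<close>

definition Grassmannian :: "nat \<Rightarrow> nat \<Rightarrow> 'a::field vec set set" where
  "Grassmannian d n = {W. VectorSpace.subspace class_ring W (module_vec TYPE('a) n) \<and>
     vectorspace.dim class_ring (module_vec TYPE('a) n \<lparr>carrier := W\<rparr>) = d}"

text \<open>A point of the product of the \<open>Gr(d\<^sub>i; n)\<close> is the list of its components.\<close>

definition Gr_prod :: "nat list \<Rightarrow> nat \<Rightarrow> 'a::field vec set list set" where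
  "Gr_prod ds n = listset (map (\<lambda>d. Grassmannian d n) ds)"

definition GL :: "nat \<Rightarrow> 'a::field mat monoid" where
  "GL n = units_of (ring_mat TYPE('a) n ())"

definition scalar_mats :: "nat \<Rightarrow> 'a::field mat set" where
  "scalar_mats n = {c \<cdot>\<^sub>m 1\<^sub>m n | c. c \<noteq> 0}"

definition PGL :: "nat \<Rightarrow> 'a::field mat set monoid" where
  "PGL n = GL n Mod scalar_mats n"

text \<open>An element of \<open>PGL n\<close> is a class \<open>C\<close> of proportional invertible matrices. All of them
  map a linear subspace \<open>W\<close> to the same subspace, which is therefore the set of all \<open>g w\<close>
  with \<open>g \<in> C\<close> and \<open>w \<in> W\<close>.\<close>

definition PGL_act :: "'a::field mat set \<Rightarrow> 'a vec set \<Rightarrow> 'a vec set" where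
  "PGL_act C W = {g *\<^sub>v w | g w. g \<in> C \<and> w \<in> W}"

definition diag_act :: "'a::field mat set \<Rightarrow> 'a vec set list \<Rightarrow> 'a vec set list" where
  "diag_act C Ws = map (PGL_act C) Ws"

section \<open>Pluecker coordinates and the Zariski topology\<close>

text \<open>The columns of \<open>basis_mat d n W\<close> are a basis of the \<open>d\<close>-dimensional subspace \<open>W\<close>:
  there are \<open>d\<close> of them and they span \<open>W\<close>. Another choice of basis multiplies all Pluecker
  coordinates of \<open>W\<close> by the same nonzero scalar.\<close>

definition basis_mat :: "nat \<Rightarrow> nat \<Rightarrow> 'a::field vec set \<Rightarrow> 'a mat" where
  "basis_mat d n W = (SOME M. M \<in> carrier_mat n d \<and> vec_space.col_space n M = W)"

definition pluecker :: "nat \<Rightarrow> nat \<Rightarrow> 'a::field vec set \<Rightarrow> nat set \<Rightarrow> 'a" where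
  "pluecker d n W I = det (submatrix (basis_mat d n W) I {..<d})"

text \<open>The variable \<open>(i, I)\<close> stands for the Pluecker coordinate with row set \<open>I\<close> of the
  \<open>i\<close>-th subspace.\<close>

type_synonym pvar = "nat \<times> nat set"

type_synonym 'a mpoly = "(pvar \<Rightarrow>\<^sub>0 nat) \<Rightarrow>\<^sub>0 'a"

definition pluecker_vars :: "nat list \<Rightarrow> nat \<Rightarrow> pvar set" where
  "pluecker_vars ds n = {(i, I). i < length ds \<and> I \<subseteq> {..<n} \<and> card I = ds ! i}"

definition block_degree :: "nat \<Rightarrow> (pvar \<Rightarrow>\<^sub>0 nat) \<Rightarrow> nat" where
  "block_degree i m = (\<Sum>v \<in> {v \<in> Poly_Mapping.keys m. fst v = i}. Poly_Mapping.lookup m v)"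

definition multihomogeneous :: "nat list \<Rightarrow> nat \<Rightarrow> 'a::field mpoly \<Rightarrow> bool" where
  "multihomogeneous ds n p \<longleftrightarrow>
     (\<forall>m \<in> Poly_Mapping.keys p. Poly_Mapping.keys m \<subseteq> pluecker_vars ds n) \<and>
     (\<exists>e. \<forall>m \<in> Poly_Mapping.keys p. \<forall>i < length ds. block_degree i m = e i)"

definition mon_eval :: "('v \<Rightarrow> 'a) \<Rightarrow> ('v \<Rightarrow>\<^sub>0 nat) \<Rightarrow> 'a::comm_semiring_1" where
  "mon_eval x m = (\<Prod>v \<in> Poly_Mapping.keys m. x v ^ Poly_Mapping.lookup m v)"

definition poly_eval :: "('v \<Rightarrow> 'a) \<Rightarrow> (('v \<Rightarrow>\<^sub>0 nat) \<Rightarrow>\<^sub>0 'a) \<Rightarrow> 'a::comm_semiring_1" where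
  "poly_eval x p = (\<Sum>m \<in> Poly_Mapping.keys p. Poly_Mapping.lookup p m * mon_eval x m)"

definition pluecker_eval :: "nat list \<Rightarrow> nat \<Rightarrow> 'a::field vec set list \<Rightarrow> 'a mpoly \<Rightarrow> 'a" where
  "pluecker_eval ds n Ws p = poly_eval (\<lambda>(i, I). pluecker (ds ! i) n (Ws ! i) I) p"

definition zero_locus :: "nat list \<Rightarrow> nat \<Rightarrow> 'a::field mpoly set \<Rightarrow> 'a vec set list set" where
  "zero_locus ds n F = {Ws \<in> Gr_prod ds n. \<forall>p \<in> F. pluecker_eval ds n Ws p = 0}"

text \<open>The product of Grassmannians is a closed subvariety of a product of projective spaces,
  whose closed sets are the zero loci of sets of multihomogeneous polynomials. This is finer
  than the product of the Zariski topologies of the factors.\<close>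

definition zariski_topology :: "nat list \<Rightarrow> nat \<Rightarrow> 'a::field vec set list topology" where
  "zariski_topology ds n = topology (\<lambda>U. U \<subseteq> Gr_prod ds n \<and>
     (\<exists>F. (\<forall>p \<in> F. multihomogeneous ds n p) \<and> Gr_prod ds n - U = zero_locus ds n F))"

section \<open>Dense dimension vectors\<close>

definition dimension_vector :: "nat list \<Rightarrow> nat \<Rightarrow> bool" where
  "dimension_vector ds n \<longleftrightarrow> (\<forall>d \<in> set ds. 1 \<le> d \<and> d < n)"

text \<open>Entries \<open>0\<close> and \<open>n\<close> are allowed here; they contribute factors that are points.\<close>

definition dense :: "'a::alg_closed_field itself \<Rightarrow> nat list \<Rightarrow> nat \<Rightarrow> bool" where
  "dense _ ds n \<longleftrightarrow> (\<exists>Ws \<in> Gr_prod ds n :: 'a vec set list set.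
     zariski_topology ds n closure_of orbit (PGL n) diag_act Ws = Gr_prod ds n)"

section \<open>Every subspace has a basis matrix\<close>

lemma basis_mat_exists:
  fixes W :: "'a::field vec set"
  assumes "W \<in> Grassmannian d n"
  shows "\<exists>M. M \<in> carrier_mat n d \<and> vec_space.col_space n M = W"
proof -
  interpret vec_space "TYPE('a)" n .
  have sub: "VectorSpace.subspace class_ring W V"
    and dim: "vectorspace.dim class_ring (vs W) = d"
    using assms by (auto simp: Grassmannian_def)
  interpret W: vectorspace class_ring "vs W"
    using sub by (rule subspace_is_vs)
  have sm: "submodule class_ring W V"
    using sub by (simp add: VectorSpace.subspace_def)
  have "W.fin_dim"
  proof -
    have "\<exists>A. finite A \<and> maximal A (\<lambda>S. S \<subseteq> carrier (vs W) \<and> W.lin_indpt S)"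
    proof (rule maximal_exists[where N = n and B = "{}"])
      fix S assume S: "S \<subseteq> carrier (vs W) \<and> W.lin_indpt S"
      then have "lin_indpt S"
        using span_li_not_depend(2)[OF _ sm, of S] by auto
      moreover have "S \<subseteq> carrier V"
        using S sm submodule.subset by fastforce
      ultimately show "finite S \<and> card S \<le> n"
        using li_le_dim[OF fin_dim, of S] dim_is_n by simp
    qed (auto simp: W.lin_dep_def)
    then show ?thesis
      unfolding W.fin_dim_def using W.max_li_is_gen by (auto simp: maximal_def)
  qed
  then have "\<exists>m. \<exists>A. finite A \<and> card A = m \<and> A \<subseteq> carrier (vs W) \<and> W.gen_set A"
    unfolding W.fin_dim_def by blast
  from LeastI_ex[OF this] obtain A where A: "finite A" "card A = d" "A \<subseteq> W" "W.span A = W"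
    using dim unfolding W.dim_def by auto
  have W: "span A = W"
    using span_li_not_depend(1)[OF A(3) sm] A(4) by simp
  obtain xs where xs: "set xs = A" "length xs = d"
    using A(1,2) by (metis finite_distinct_list distinct_card)
  have "W \<subseteq> carrier_vec n"
    using sm submodule.subset by fastforce
  then have "cols (mat_of_cols n xs) = xs"
    using A(3) xs(1) by (intro cols_mat_of_cols) blast
  then have "col_space (mat_of_cols n xs) = W"
    using W xs(1) by (simp add: col_space_def)
  then show ?thesis
    using xs(2) mat_of_cols_carrier(1)[of n xs] by blast
qed

section \<open>The closed sets form a topology\<close>

lemma poly_eval_superset:
  "finite M \<Longrightarrow> Poly_Mapping.keys p \<subseteq> M \<Longrightarrow> poly_eval x p = (\<Sum>m \<in> M. Poly_Mapping.lookup p m * mon_eval x m)"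
  unfolding poly_eval_def by (rule sum.mono_neutral_left) (auto simp: in_keys_iff)

lemma poly_eval_add: "poly_eval x (p + q) = poly_eval x p + poly_eval x q"
proof -
  let ?M = "Poly_Mapping.keys p \<union> Poly_Mapping.keys q"
  have "poly_eval x (p + q) = (\<Sum>m \<in> ?M. Poly_Mapping.lookup (p + q) m * mon_eval x m)"
    by (rule poly_eval_superset) (simp_all add: Poly_Mapping.keys_add)
  also have "\<dots> = (\<Sum>m \<in> ?M. Poly_Mapping.lookup p m * mon_eval x m) + (\<Sum>m \<in> ?M. Poly_Mapping.lookup q m * mon_eval x m)"
    by (simp add: lookup_add distrib_right sum.distrib)
  also have "\<dots> = poly_eval x p + poly_eval x q"
    by (simp add: poly_eval_superset[of ?M])
  finally show ?thesis .
qed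

lemma poly_eval_zero [simp]: "poly_eval x 0 = 0"
  by (simp add: poly_eval_def)

lemma poly_eval_sum: "poly_eval x (sum f A) = (\<Sum>a \<in> A. poly_eval x (f a))"
  by (induction A rule: infinite_finite_induct) (auto simp: poly_eval_add)

lemma poly_eval_single [simp]: "poly_eval x (Poly_Mapping.single m c) = c * mon_eval x m"
  by (simp add: poly_eval_def)

lemma mon_eval_superset:
  "finite V \<Longrightarrow> Poly_Mapping.keys m \<subseteq> V \<Longrightarrow> mon_eval x m = (\<Prod>v \<in> V. x v ^ Poly_Mapping.lookup m v)"
  unfolding mon_eval_def by (rule prod.mono_neutral_left) (auto simp: in_keys_iff)

lemma mon_eval_add: "mon_eval x (m + m') = mon_eval x m * mon_eval x m'"
proof -
  let ?V = "Poly_Mapping.keys m \<union> Poly_Mapping.keys m'"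
  have "mon_eval x (m + m') = (\<Prod>v \<in> ?V. x v ^ Poly_Mapping.lookup (m + m') v)"
    by (rule mon_eval_superset) (simp_all add: Poly_Mapping.keys_add)
  also have "\<dots> = mon_eval x m * mon_eval x m'"
    by (simp add: lookup_add power_add prod.distrib mon_eval_superset[of ?V])
  finally show ?thesis .
qed

lemma poly_mapping_eq_sum_single:
  fixes p :: "'k \<Rightarrow>\<^sub>0 'c::comm_monoid_add"
  shows "p = (\<Sum>m \<in> Poly_Mapping.keys p. Poly_Mapping.single m (Poly_Mapping.lookup p m))"
proof (rule poly_mapping_eqI)
  fix k
  have "(\<Sum>m \<in> Poly_Mapping.keys p. Poly_Mapping.lookup (Poly_Mapping.single m (Poly_Mapping.lookup p m)) k) =
      (\<Sum>m \<in> Poly_Mapping.keys p. if m = k then Poly_Mapping.lookup p k else 0)"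
    by (rule sum.cong) (auto simp: lookup_single)
  then show "Poly_Mapping.lookup p k = Poly_Mapping.lookup (\<Sum>m \<in> Poly_Mapping.keys p. Poly_Mapping.single m (Poly_Mapping.lookup p m)) k"
    by (simp add: lookup_sum in_keys_iff)
qed

lemma poly_eval_mult: "poly_eval x (p * q) = poly_eval x p * poly_eval x q"
proof -
  have "p * q = (\<Sum>m \<in> Poly_Mapping.keys p. \<Sum>m' \<in> Poly_Mapping.keys q.
      Poly_Mapping.single (m + m') (Poly_Mapping.lookup p m * Poly_Mapping.lookup q m'))"
    by (subst poly_mapping_eq_sum_single[of p], subst poly_mapping_eq_sum_single[of q])
      (simp add: sum_product mult_single)
  then have "poly_eval x (p * q) = (\<Sum>m \<in> Poly_Mapping.keys p. \<Sum>m' \<in> Poly_Mapping.keys q.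
      (Poly_Mapping.lookup p m * Poly_Mapping.lookup q m') * mon_eval x (m + m'))"
    by (simp add: poly_eval_sum)
  also have "\<dots> = poly_eval x p * poly_eval x q"
    by (simp add: poly_eval_def sum_product mon_eval_add mult_ac)
  finally show ?thesis .
qed

lemma block_degree_add: "block_degree i (m + m') = block_degree i m + block_degree i m'"
proof -
  let ?V = "{v \<in> Poly_Mapping.keys m \<union> Poly_Mapping.keys m'. fst v = i}"
  have *: "block_degree i k = (\<Sum>v \<in> ?V. Poly_Mapping.lookup k v)" if "Poly_Mapping.keys k \<subseteq> Poly_Mapping.keys m \<union> Poly_Mapping.keys m'" for k
    unfolding block_degree_def
  proof (rule sum.mono_neutral_left)
    show "{v \<in> Poly_Mapping.keys k. fst v = i} \<subseteq> ?V" using that by blast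
  qed (auto simp: in_keys_iff)
  show ?thesis
    by (simp add: * Poly_Mapping.keys_add lookup_add sum.distrib)
qed

lemma multihomogeneous_mult:
  assumes "multihomogeneous ds n p" "multihomogeneous ds n q"
  shows "multihomogeneous ds n (p * q)"
proof -
  obtain e e' where e: "\<forall>m \<in> Poly_Mapping.keys p. \<forall>i < length ds. block_degree i m = e i"
    and e': "\<forall>m \<in> Poly_Mapping.keys q. \<forall>i < length ds. block_degree i m = e' i"
    using assms unfolding multihomogeneous_def by blast
  have k: "\<exists>a b. m = a + b \<and> a \<in> Poly_Mapping.keys p \<and> b \<in> Poly_Mapping.keys q" if "m \<in> Poly_Mapping.keys (p * q)" for m
    using that keys_mult[of p q] by auto
  have "Poly_Mapping.keys m \<subseteq> pluecker_vars ds n" if m: "m \<in> Poly_Mapping.keys (p * q)" for m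
  proof -
    obtain a b where "m = a + b" "a \<in> Poly_Mapping.keys p" "b \<in> Poly_Mapping.keys q" using k[OF m] by blast
    then show ?thesis
      using assms Poly_Mapping.keys_add[of a b] unfolding multihomogeneous_def by blast
  qed
  moreover have "\<forall>m \<in> Poly_Mapping.keys (p * q). \<forall>i < length ds. block_degree i m = e i + e' i"
    using k e e' by (metis block_degree_add)
  ultimately show ?thesis
    unfolding multihomogeneous_def by (intro conjI exI[of _ "\<lambda>i. e i + e' i"]) auto
qed

lemma zero_locus_Un:
  "zero_locus ds n F \<union> zero_locus ds n G = zero_locus ds n {p * q | p q. p \<in> F \<and> q \<in> G}"
proof (intro equalityI subsetI)
  fix Ws assume "Ws \<in> zero_locus ds n F \<union> zero_locus ds n G"
  then show "Ws \<in> zero_locus ds n {p * q | p q. p \<in> F \<and> q \<in> G}"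
    unfolding zero_locus_def by (auto simp: pluecker_eval_def poly_eval_mult)
next
  fix Ws assume Ws: "Ws \<in> zero_locus ds n {p * q | p q. p \<in> F \<and> q \<in> G}"
  have "pluecker_eval ds n Ws p = 0 \<or> pluecker_eval ds n Ws q = 0" if "p \<in> F" "q \<in> G" for p q
  proof -
    have "pluecker_eval ds n Ws (p * q) = 0"
      using Ws that unfolding zero_locus_def by blast
    then show ?thesis by (simp add: pluecker_eval_def poly_eval_mult)
  qed
  then show "Ws \<in> zero_locus ds n F \<union> zero_locus ds n G"
    using Ws unfolding zero_locus_def by blast
qed

lemma istopology_zariski:
  "istopology (\<lambda>U. U \<subseteq> (Gr_prod ds n :: 'a::field vec set list set) \<and>
     (\<exists>F. (\<forall>p \<in> F. multihomogeneous ds n p) \<and> Gr_prod ds n - U = zero_locus ds n F))"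
  (is "istopology ?L")
  unfolding istopology_def
proof (intro conjI allI impI)
  fix S T :: "'a vec set list set"
  assume S: "?L S" and T: "?L T"
  obtain F where F: "\<forall>p \<in> F. multihomogeneous ds n p" "Gr_prod ds n - S = zero_locus ds n F"
    using S by blast
  obtain G where G: "\<forall>p \<in> G. multihomogeneous ds n p" "Gr_prod ds n - T = zero_locus ds n G"
    using T by blast
  have "\<forall>p \<in> {p * q | p q. p \<in> F \<and> q \<in> G}. multihomogeneous ds n p"
    using F(1) G(1) by (auto intro: multihomogeneous_mult)
  moreover have "Gr_prod ds n - (S \<inter> T) = zero_locus ds n {p * q | p q. p \<in> F \<and> q \<in> G}"
    using F(2) G(2) zero_locus_Un[of ds n F G] by (simp add: Diff_Int)
  ultimately show "\<exists>F. (\<forall>p \<in> F. multihomogeneous ds n p) \<and>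
      Gr_prod ds n - (S \<inter> T) = zero_locus ds n F" by blast
  show "S \<inter> T \<subseteq> Gr_prod ds n" using S by blast
next
  fix K :: "'a vec set list set set"
  assume K: "\<forall>U \<in> K. ?L U"
  then obtain F where F: "\<And>U. U \<in> K \<Longrightarrow> (\<forall>p \<in> F U. multihomogeneous ds n p) \<and>
      Gr_prod ds n - U = zero_locus ds n (F U)"
    by metis
  have "Gr_prod ds n - \<Union>K = {Ws \<in> Gr_prod ds n. \<forall>U \<in> K. Ws \<in> Gr_prod ds n - U}"
    by blast
  also have "\<dots> = {Ws \<in> Gr_prod ds n. \<forall>U \<in> K. Ws \<in> zero_locus ds n (F U)}"
    using F by auto
  also have "\<dots> = zero_locus ds n (\<Union>U \<in> K. F U)"
    by (auto simp: zero_locus_def)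
  finally have "Gr_prod ds n - \<Union>K = zero_locus ds n (\<Union>U \<in> K. F U)" .
  moreover have "\<forall>p \<in> (\<Union>U \<in> K. F U). multihomogeneous ds n p"
    using F by blast
  ultimately show "\<exists>F. (\<forall>p \<in> F. multihomogeneous ds n p) \<and>
      Gr_prod ds n - \<Union>K = zero_locus ds n F" by blast
  show "\<Union>K \<subseteq> Gr_prod ds n" using K by blast
qed

lemma openin_zariski:
  "openin (zariski_topology ds n) U \<longleftrightarrow> U \<subseteq> Gr_prod ds n \<and>
     (\<exists>F. (\<forall>p \<in> F. multihomogeneous ds n p) \<and> Gr_prod ds n - U = zero_locus ds n F)"
  unfolding zariski_topology_def topology_inverse'[OF istopology_zariski] ..

lemma topspace_zariski: "topspace (zariski_topology ds n) = Gr_prod ds n"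
proof -
  have "multihomogeneous ds n 1"
    by (auto simp: multihomogeneous_def)
  moreover have "Gr_prod ds n - Gr_prod ds n = zero_locus ds n {1}"
    by (auto simp: zero_locus_def pluecker_eval_def poly_eval_def mon_eval_def)
  ultimately have "openin (zariski_topology ds n) (Gr_prod ds n)"
    unfolding openin_zariski by blast
  then show ?thesis
    unfolding topspace_def openin_zariski by blast
qed

end

theory Submission
  imports Defs
begin

text \<open>
  Write \<open>m = n - k\<close>. A configuration consists of subspaces \<open>A\<^sub>i\<close> of dimensions \<open>a\<^sub>i\<close> and
  \<open>B\<^sub>j\<close> of codimensions \<open>n - b\<^sub>j\<close> in the \<open>n\<close>-dimensional space. Since \<open>\<Sum> a\<^sub>i = m\<close>, the \<open>A\<^sub>i\<close> of a
  generic configuration lie in a subspace \<open>U\<close> of dimension \<open>m\<close>. Since the codimensions of the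
  \<open>B\<^sub>j\<close> have sum at most \<open>m\<close>, the intersection of the \<open>B\<^sub>j\<close> contains a subspace \<open>K\<close> of dimension
  \<open>k\<close>, and generically \<open>K\<close> is a complement of \<open>U\<close>. Then \<open>B\<^sub>j = (B\<^sub>j \<inter> U) \<oplus> K\<close>, so the whole
  configuration is the image, under some \<open>h \<in> GL(n)\<close>, of a configuration with dimension vector
  \<open>(a\<^sub>i, b\<^sub>j - k; m)\<close>: the \<open>A\<close>-parts are placed into the first \<open>m\<close> coordinates, and the \<open>B\<close>-parts
  are enlarged by the span of the last \<open>k\<close> unit vectors.

  Take a point whose \<open>GL(m)\<close>-orbit is dense for \<open>(a\<^sub>i, b\<^sub>j - k; m)\<close> and enlarge it in this way;
  the claim is that the \<open>GL(n)\<close>-orbit of the result is dense. Let a multihomogeneous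
  polynomial \<open>p\<close> vanish on this orbit. For each fixed \<open>h\<close>, the value of \<open>p\<close> at
  the \<open>h\<close>-image of an enlarged configuration is a multihomogeneous polynomial in the Pluecker
  coordinates of the small configuration (\<open>minor_eval_mult_extend_id\<close>, which rests on a form of the
  Cauchy-Binet formula). It vanishes on a dense orbit, hence everywhere. So \<open>p\<close> vanishes at every
  configuration that splits as above.

  It remains to see that this forces \<open>p\<close> to vanish at an arbitrary configuration. Every subspace is
  \<open>P E\<close> for an invertible \<open>P\<close> and a coordinate subspace \<open>E\<close>. Choose the coordinate subspaces
  so that they split themselves (disjoint blocks of the first \<open>m\<close> coordinates for the \<open>A\<^sub>i\<close>,
  complements of such blocks for the \<open>B\<^sub>j\<close>), and join each \<open>P\<close> to the identity by a line of
  matrices. Bases of \<open>U\<close> and \<open>K\<close> are then given by polynomials in the parameter, and the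
  conditions for the splitting are the nonvanishing of certain determinants, which equal \<open>1\<close>
  at the identity (\<open>generic_configuration\<close>). Hence \<open>p\<close> vanishes at all but finitely many points of
  the line, and so on the whole line, because the field is infinite.
\<close>

section \<open>Images of coordinate subspaces\<close>

definition coord_space :: "nat \<Rightarrow> nat set \<Rightarrow> 'a::field vec set" where
  "coord_space n S = {x \<in> carrier_vec n. \<forall>i<n. i \<notin> S \<longrightarrow> x $ i = 0}"

text \<open>The span of the columns of \<open>P\<close> with index in \<open>S\<close>. With \<open>P\<close> ranging over the
  invertible matrices, this is the action of \<open>GL(n)\<close> on one point of a Grassmannian, and it is the
  form in which all subspaces are handled below.\<close>

definition colspan :: "nat \<Rightarrow> 'a::field mat \<Rightarrow> nat set \<Rightarrow> 'a vec set" where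
  "colspan n P S = (\<lambda>x. P *\<^sub>v x) ` coord_space n S"

definition colmat :: "nat \<Rightarrow> 'a mat \<Rightarrow> nat set \<Rightarrow> 'a mat" where
  "colmat n P S = mat n (card S) (\<lambda>(i, b). P $$ (i, pick S b))"

lemma colmat_carrier [simp]: "colmat n P S \<in> carrier_mat n (card S)"
  by (simp add: colmat_def)

lemma bij_betw_pick:
  assumes "finite S"
  shows "bij_betw (pick S) {..<card S} S"
proof -
  have inj: "inj_on (pick S) {..<card S}"
    by (rule linorder_inj_onI') (use pick_mono[of _ S] in force)
  moreover have sub: "pick S ` {..<card S} \<subseteq> S"
    using pick_in_set by auto
  moreover have "card (pick S ` {..<card S}) = card S"
    by (simp add: card_image inj)
  ultimately show ?thesis
    using card_subset_eq[OF assms sub] by (simp add: bij_betw_def)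
qed

lemma pick_lessThan: "i < n \<Longrightarrow> pick {..<n} i = i"
  using pick_reduce_set[of i n UNIV] by (simp add: pick_UNIV lessThan_def)

lemma colspan_eq_col_space:
  assumes P: "P \<in> carrier_mat n n" and S: "S \<subseteq> {..<n}"
  shows "colspan n P S = vec_space.col_space n (colmat n P S)"
proof -
  interpret vec_space "TYPE('a)" n .
  have fS: "finite S" using S finite_subset by blast
  have pn: "pick S b < n" if "b < card S" for b
    using pick_in_set[of b S] that S by auto
  have mult: "P *\<^sub>v y = colmat n P S *\<^sub>v x"
    if y: "y \<in> coord_space n S" and x: "x \<in> carrier_vec (card S)"
      and xy: "\<And>b. b < card S \<Longrightarrow> x $ b = y $ pick S b" for x y
  proof (rule eq_vecI)
    fix i assume "i < dim_vec (colmat n P S *\<^sub>v x)"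
    then have i: "i < n" by (simp add: colmat_def)
    have "(P *\<^sub>v y) $ i = (\<Sum>l \<in> {0..<n}. P $$ (i, l) * y $ l)"
      using P y i by (auto simp: scalar_prod_def coord_space_def intro!: sum.cong)
    also have "\<dots> = (\<Sum>l \<in> S. P $$ (i, l) * y $ l)"
      using S y by (intro sum.mono_neutral_right) (auto simp: coord_space_def)
    also have "\<dots> = (\<Sum>b \<in> {..<card S}. P $$ (i, pick S b) * y $ pick S b)"
      using sum.reindex_bij_betw[OF bij_betw_pick[OF fS], of "\<lambda>l. P $$ (i, l) * y $ l"] by simp
    also have "\<dots> = (colmat n P S *\<^sub>v x) $ i"
      using i x xy by (auto simp: colmat_def scalar_prod_def intro!: sum.cong)
    finally show "(P *\<^sub>v y) $ i = (colmat n P S *\<^sub>v x) $ i" .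
  qed (use P in \<open>auto simp: colmat_def\<close>)
  have cs: "col_space (colmat n P S) = {y \<in> carrier_vec n. \<exists>x \<in> carrier_vec (card S). colmat n P S *\<^sub>v x = y}"
    by (subst col_space_eq[of _ "card S"]) (auto simp: colmat_def)
  show ?thesis
    unfolding cs
  proof (intro equalityI subsetI)
    fix w assume "w \<in> colspan n P S"
    then obtain y where y: "y \<in> coord_space n S" "w = P *\<^sub>v y"
      by (auto simp: colspan_def)
    have "w = colmat n P S *\<^sub>v vec (card S) (\<lambda>b. y $ pick S b)"
      unfolding y(2) by (rule mult) (use y in auto)
    then show "w \<in> {y \<in> carrier_vec n. \<exists>x \<in> carrier_vec (card S). colmat n P S *\<^sub>v x = y}"
      using mult_mat_vec_carrier[OF colmat_carrier, of "vec (card S) (\<lambda>b. y $ pick S b)" S n P] by auto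
  next
    fix w assume "w \<in> {y \<in> carrier_vec n. \<exists>x \<in> carrier_vec (card S). colmat n P S *\<^sub>v x = y}"
    then obtain x where x: "x \<in> carrier_vec (card S)" "w = colmat n P S *\<^sub>v x" by auto
    define y where "y = vec n (\<lambda>l. if l \<in> S then x $ card {a \<in> S. a < l} else 0)"
    have y: "y \<in> coord_space n S" by (auto simp: y_def coord_space_def)
    have "P *\<^sub>v y = colmat n P S *\<^sub>v x"
      by (rule mult[OF y x(1)]) (use pn pick_in_set[of _ S] card_pick[of _ S] in \<open>auto simp: y_def\<close>)
    then show "w \<in> colspan n P S"
      unfolding colspan_def x(2) using y by (metis image_eqI)
  qed
qed

lemma set_cols_colmat:
  assumes P: "P \<in> carrier_mat n n" and S: "S \<subseteq> {..<n}"
  shows "set (cols (colmat n P S)) = col P ` S"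
proof -
  have fS: "finite S" using S finite_subset by blast
  have "set (cols (colmat n P S)) = (\<lambda>b. col P (pick S b)) ` {..<card S}"
  proof -
    have "col (colmat n P S) b = col P (pick S b)" if "b < card S" for b
      using that P S pick_in_set[of b S] by (intro eq_vecI) (auto simp: colmat_def)
    then show ?thesis
      by (auto simp: cols_def colmat_def)
  qed
  then show ?thesis
    using bij_betw_imp_surj_on[OF bij_betw_pick[OF fS]] by (metis image_image)
qed

lemma colspan_in_Grassmannian:
  fixes P :: "'a::field mat"
  assumes P: "P \<in> carrier_mat n n" and dP: "det P \<noteq> 0" and S: "S \<subseteq> {..<n}"
  shows "colspan n P S \<in> Grassmannian (card S) n"
proof -
  interpret vec_space "TYPE('a)" n .
  have fS: "finite S" using S finite_subset by blast
  define A where "A = col P ` S"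
  have AV: "A \<subseteq> carrier_vec n"
    using P S by (auto simp: A_def)
  have fA: "finite A" using fS by (simp add: A_def)
  have W: "colspan n P S = span A"
    by (simp add: colspan_eq_col_space[OF P S] col_space_def set_cols_colmat[OF P S] A_def)
  have sub: "VectorSpace.subspace class_ring (span A) V"
    using span_is_subspace[OF AV] .
  have sm: "submodule class_ring (span A) V"
    using sub by (simp add: VectorSpace.subspace_def)
  interpret W: vectorspace class_ring "vs (span A)"
    using sub by (rule subspace_is_vs)
  have "lin_indpt (set (cols P))"
    using lin_dep_cols_imp_det_0[OF P] dP by blast
  moreover have "A \<subseteq> set (cols P)"
    using P S by (auto simp: A_def cols_def)
  ultimately have li: "lin_indpt A"
    using supset_ld_is_ld by blast
  have AW: "A \<subseteq> span A" using AV by (rule in_own_span)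
  have "W.lin_indpt A"
    using span_li_not_depend(2)[OF AW sm] li by simp
  moreover have "W.gen_set A"
    using span_li_not_depend(1)[OF AW sm] by simp
  ultimately have "W.basis A"
    using AW by (simp add: W.basis_def)
  then have "W.dim = card A"
    using fA by (rule W.dim_basis[rotated])
  moreover have "inj_on (col P) S"
  proof (rule inj_onI)
    fix i j assume ij: "i \<in> S" "j \<in> S" "col P i = col P j"
    show "i = j"
    proof (rule ccontr)
      assume "i \<noteq> j"
      then have "det P = 0"
        using det_identical_columns[OF P, of i j] ij S by auto
      then show False using dP by simp
    qed
  qed
  then have "card A = card S"
    by (simp add: A_def card_image)
  ultimately show ?thesis
    unfolding W Grassmannian_def using sub by simp
qed

text \<open>A basis of \<open>W\<close> extends to a basis of the whole space. Its members become the
  columns of \<open>P\<close>, those from \<open>W\<close> at the positions in \<open>S\<close>.\<close>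

lemma Grassmannian_colspan:
  fixes W :: "'a::field vec set"
  assumes W: "W \<in> Grassmannian (card S) n" and S: "S \<subseteq> {..<n}"
  obtains P where "P \<in> carrier_mat n n" "det P \<noteq> 0" "W = colspan n P S"
proof -
  interpret vec_space "TYPE('a)" n .
  have fS: "finite S" using S finite_subset by blast
  have sub: "VectorSpace.subspace class_ring W V"
    and dim: "vectorspace.dim class_ring (vs W) = card S"
    using W by (auto simp: Grassmannian_def)
  interpret W: vectorspace class_ring "vs W"
    using sub by (rule subspace_is_vs)
  have sm: "submodule class_ring W V"
    using sub by (simp add: VectorSpace.subspace_def)
  obtain M where M: "M \<in> carrier_mat n (card S)" "col_space M = W"
    using basis_mat_exists[OF W] by blast
  define A where "A = set (cols M)"
  have fA: "finite A" by (simp add: A_def)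
  have AV: "A \<subseteq> carrier_vec n"
    using M cols_dim[of M] by (auto simp: A_def)
  have spA: "span A = W" using M by (simp add: A_def col_space_def)
  have AW: "A \<subseteq> W" using in_own_span[OF AV] spA by simp
  have genA: "W.gen_set A"
    using span_li_not_depend(1)[OF AW sm] spA by simp
  have cA: "card A \<le> card S"
    using card_length[of "cols M"] M(1) by (simp add: A_def)
  have "W.dim \<le> card A"
    using W.gen_ge_dim[OF fA _ genA] AW by simp
  then have card_A: "card A = card S" using cA dim by simp
  then have "W.basis A"
    using W.dim_gen_is_basis[OF fA _ genA] AW dim by simp
  then have "W.lin_indpt A" by (simp add: W.basis_def)
  then have liA: "lin_indpt A"
    using span_li_not_depend(2)[OF AW sm] by simp
  have "\<exists>B. finite B \<and> maximal B (\<lambda>B. A \<subseteq> B \<and> B \<subseteq> carrier_vec n \<and> lin_indpt B)"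
  proof (rule maximal_exists[where N = n and B = A])
    fix B assume "A \<subseteq> B \<and> B \<subseteq> carrier_vec n \<and> lin_indpt B"
    then show "finite B \<and> card B \<le> n"
      using li_le_dim[OF fin_dim, of B] dim_is_n by simp
  qed (use AV liA in auto)
  then obtain B where fB: "finite B" and B: "maximal B (\<lambda>B. A \<subseteq> B \<and> B \<subseteq> carrier_vec n \<and> lin_indpt B)"
    by blast
  have AB: "A \<subseteq> B" and BV: "B \<subseteq> carrier_vec n"
    using B by (auto simp: maximal_def)
  have "maximal B (\<lambda>B. B \<subseteq> carrier_vec n \<and> lin_indpt B)"
    using B AB unfolding maximal_def by blast
  then have bas: "basis B"
    using max_li_is_basis by blast
  then have card_B: "card B = n"
    using dim_basis[OF fB] dim_is_n by simp
  obtain f where f: "bij_betw f S A"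
    using finite_same_card_bij[OF fS fA] card_A by auto
  have "card ({..<n} - S) = card (B - A)"
    using card_A card_B AB fA S fS by (simp add: card_Diff_subset)
  then obtain g where g: "bij_betw g ({..<n} - S) (B - A)"
    using finite_same_card_bij[of "{..<n} - S" "B - A"] fB by auto
  define e where "e l = (if l \<in> S then f l else g l)" for l
  define P where "P = mat n n (\<lambda>(i, l). e l $ i)"
  have P: "P \<in> carrier_mat n n" by (simp add: P_def)
  have eS: "e ` S = A"
    using f by (auto simp: e_def bij_betw_def)
  have en: "e ` {..<n} = B"
  proof -
    have "e ` {..<n} = e ` S \<union> e ` ({..<n} - S)" using S by blast
    also have "e ` ({..<n} - S) = B - A"
      using g by (auto simp: e_def bij_betw_def)
    finally show ?thesis using eS AB by blast
  qed
  have colP: "col P l = e l" if "l < n" for l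
  proof -
    have "e l \<in> carrier_vec n" using that en BV by auto
    then show ?thesis using that by (intro eq_vecI) (auto simp: P_def)
  qed
  have "col P ` S = A"
    using eS S colP by (metis image_cong lessThan_iff subsetD)
  then have "colspan n P S = W"
    by (simp add: colspan_eq_col_space[OF P S] col_space_def set_cols_colmat[OF P S] spA)
  moreover have "det P \<noteq> 0"
  proof -
    have "set (cols P) = B"
      using en colP P by (auto simp: cols_def)
    then have "col_space P = carrier_vec n"
      using bas by (simp add: col_space_def basis_def)
    then have "\<forall>i<n. \<exists>x \<in> carrier_vec n. P *\<^sub>v x = unit_vec n i"
      using col_space_eq[OF P] P by auto
    then obtain x where x: "\<And>i. i < n \<Longrightarrow> x i \<in> carrier_vec n \<and> P *\<^sub>v x i = unit_vec n i"
      by metis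
    define X where "X = mat n n (\<lambda>(l, i). x i $ l)"
    have X: "X \<in> carrier_mat n n" by (simp add: X_def)
    have colX: "col X i = x i" if "i < n" for i
      using that x[OF that] by (intro eq_vecI) (auto simp: X_def)
    have "P * X = 1\<^sub>m n"
    proof (rule eq_matI)
      fix i j assume "i < dim_row (1\<^sub>m n :: 'a mat)" "j < dim_col (1\<^sub>m n :: 'a mat)"
      then have ij: "i < n" "j < n" by auto
      have "(P * X) $$ (i, j) = (P *\<^sub>v x j) $ i"
        using ij P X by (simp add: colX)
      then show "(P * X) $$ (i, j) = (1\<^sub>m n :: 'a mat) $$ (i, j)"
        using x ij by simp
    qed (use P X in auto)
    then have "det P * det X = 1"
      using det_mult[OF P X] by simp
    then show ?thesis by auto
  qed
  ultimately show thesis using that P by blast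
qed

section \<open>Minors as Pluecker coordinates\<close>

definition minor :: "'a::comm_ring_1 mat \<Rightarrow> nat set \<Rightarrow> nat set \<Rightarrow> 'a" where
  "minor P I S = det (submatrix P I S)"

lemma card_le_in: "I \<subseteq> {..<n} \<Longrightarrow> card {i. i < n \<and> i \<in> I} = card I"
  by (rule arg_cong[of _ _ card]) auto

lemma minor_colmat:
  assumes P: "P \<in> carrier_mat n n" and S: "S \<subseteq> {..<n}" and I: "I \<subseteq> {..<n}"
  shows "minor P I S = minor (colmat n P S) I {..<card S}"
proof -
  have "submatrix P I S = submatrix (colmat n P S) I {..<card S}"
  proof (rule eq_matI)
    fix a b assume "a < dim_row (submatrix (colmat n P S) I {..<card S})"
      "b < dim_col (submatrix (colmat n P S) I {..<card S})"
    then have a: "a < card I" and b: "b < card S"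
      using I by (simp_all add: dim_submatrix colmat_def card_le_in)
    have "pick I a < n" using pick_in_set[of a I] a I by auto
    then show "submatrix P I S $$ (a, b) = submatrix (colmat n P S) I {..<card S} $$ (a, b)"
      using P S I a b by (simp add: submatrix_def colmat_def card_le_in pick_lessThan)
  qed (use P S I in \<open>auto simp: dim_submatrix colmat_def card_le_in\<close>)
  then show ?thesis by (simp add: minor_def)
qed

lemma minor_mult_right:
  assumes M: "M \<in> carrier_mat n d" and A: "A \<in> carrier_mat d d"
    and I: "I \<subseteq> {..<n}" "card I = d"
  shows "minor (M * A) I {..<d} = minor M I {..<d} * det A"
proof -
  have "submatrix (M * A) I {..<d} = submatrix M I {..<d} * A"
  proof (rule eq_matI)
    fix a b assume "a < dim_row (submatrix M I {..<d} * A)" "b < dim_col (submatrix M I {..<d} * A)"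
    then have a: "a < d" and b: "b < d"
      using I M A by (simp_all add: dim_submatrix card_le_in)
    have "pick I a < n" using pick_in_set[of a I] a I by auto
    then show "submatrix (M * A) I {..<d} $$ (a, b) = (submatrix M I {..<d} * A) $$ (a, b)"
      using M A I a b by (auto simp: submatrix_def card_le_in pick_lessThan scalar_prod_def intro!: sum.cong)
  qed (use M A I in \<open>auto simp: dim_submatrix card_le_in\<close>)
  moreover have "submatrix M I {..<d} \<in> carrier_mat d d"
    using M I by (auto simp: dim_submatrix card_le_in)
  ultimately show ?thesis
    using A by (simp add: minor_def det_mult)
qed

lemma col_space_subset_imp_mult:
  fixes M B :: "'a::field mat"
  assumes M: "M \<in> carrier_mat n d" and B: "B \<in> carrier_mat n e"
    and sub: "vec_space.col_space n B \<subseteq> vec_space.col_space n M"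
  obtains A where "A \<in> carrier_mat d e" "B = M * A"
proof -
  interpret vec_space "TYPE('a)" n .
  have "\<exists>x \<in> carrier_vec d. M *\<^sub>v x = col B j" if j: "j < e" for j
  proof -
    have "col B j \<in> set (cols B)" using j B by (auto simp: cols_def)
    then have "col B j \<in> col_space B"
      using B cols_dim[of B] unfolding col_space_def by (intro span_mem) auto
    then show ?thesis
      using sub col_space_eq[OF M] M by auto
  qed
  then obtain x where x: "\<And>j. j < e \<Longrightarrow> x j \<in> carrier_vec d \<and> M *\<^sub>v x j = col B j"
    by metis
  define A where "A = mat d e (\<lambda>(l, j). x j $ l)"
  have A: "A \<in> carrier_mat d e" by (simp add: A_def)
  have "B = M * A"
  proof (rule eq_matI)
    fix i j assume "i < dim_row (M * A)" "j < dim_col (M * A)"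
    then have ij: "i < n" "j < e" using M A by auto
    have "col A j = x j"
      using x[OF ij(2)] ij by (intro eq_vecI) (auto simp: A_def)
    then have "(M * A) $$ (i, j) = (M *\<^sub>v x j) $ i"
      using ij M A by simp
    also have "\<dots> = col B j $ i"
      using x ij by simp
    finally show "B $$ (i, j) = (M * A) $$ (i, j)"
      using ij B by simp
  qed (use M A B in auto)
  then show thesis using that A by blast
qed

text \<open>Two matrices with the same column space differ by a square factor on the right, which
  multiplies all maximal minors by its determinant. Having the relation in both
  directions replaces the statement that this determinant is nonzero.\<close>

lemma pluecker_colspan:
  fixes P :: "'a::field mat"
  assumes P: "P \<in> carrier_mat n n" and S: "S \<subseteq> {..<n}" and d: "card S = d"
  shows "\<exists>c. \<forall>I \<subseteq> {..<n}. card I = d \<longrightarrow> pluecker d n (colspan n P S) I = c * minor P I S"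
    and "\<exists>c. \<forall>I \<subseteq> {..<n}. card I = d \<longrightarrow> minor P I S = c * pluecker d n (colspan n P S) I"
proof -
  let ?W = "colspan n P S"
  define M where "M = colmat n P S"
  define B where "B = basis_mat d n ?W"
  have M: "M \<in> carrier_mat n d" using d by (auto simp: M_def)
  have cM: "vec_space.col_space n M = ?W"
    by (simp add: M_def colspan_eq_col_space[OF P S])
  have "B \<in> carrier_mat n d \<and> vec_space.col_space n B = ?W"
    unfolding B_def basis_mat_def by (rule someI[of _ M]) (use M cM in simp)
  then have B: "B \<in> carrier_mat n d" and cB: "vec_space.col_space n B = ?W" by auto
  have pl: "pluecker d n ?W I = minor B I {..<d}" for I
    by (simp add: pluecker_def minor_def B_def)
  have mi: "minor P I S = minor M I {..<d}" if "I \<subseteq> {..<n}" for I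
    using minor_colmat[OF P S that] d by (simp add: M_def)
  obtain A where A: "A \<in> carrier_mat d d" "B = M * A"
    using col_space_subset_imp_mult[OF M B] cB cM by auto
  show "\<exists>c. \<forall>I \<subseteq> {..<n}. card I = d \<longrightarrow> pluecker d n ?W I = c * minor P I S"
    using minor_mult_right[OF M A(1)] by (auto simp: pl mi A(2) intro!: exI[of _ "det A"])
  obtain A' where A': "A' \<in> carrier_mat d d" "M = B * A'"
    using col_space_subset_imp_mult[OF B M] cB cM by auto
  show "\<exists>c. \<forall>I \<subseteq> {..<n}. card I = d \<longrightarrow> minor P I S = c * pluecker d n ?W I"
    using minor_mult_right[OF B A'(1)] by (auto simp: pl mi A'(2) intro!: exI[of _ "det A'"])
qed

text \<open>Rescaling the coordinates of each factor separately multiplies the value by one monomial in the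
  scalars. Zero scalars are allowed, so this is only an implication.\<close>

lemma multihomogeneous_scale:
  assumes p: "multihomogeneous ds n p"
    and xy: "\<And>i I. (i, I) \<in> pluecker_vars ds n \<Longrightarrow> x (i, I) = c i * y (i, I)"
    and y: "poly_eval y p = 0"
  shows "poly_eval x p = 0"
proof -
  obtain e where e: "\<And>m i. m \<in> Poly_Mapping.keys p \<Longrightarrow> i < length ds \<Longrightarrow> block_degree i m = e i"
    and v: "\<And>m. m \<in> Poly_Mapping.keys p \<Longrightarrow> Poly_Mapping.keys m \<subseteq> pluecker_vars ds n"
    using p unfolding multihomogeneous_def by blast
  let ?K = "\<Prod>i<length ds. c i ^ e i"
  have mon: "mon_eval x m = ?K * mon_eval y m" if m: "m \<in> Poly_Mapping.keys p" for m
  proof -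
    have "mon_eval x m = (\<Prod>v \<in> Poly_Mapping.keys m. (c (fst v) * y v) ^ Poly_Mapping.lookup m v)"
      unfolding mon_eval_def
    proof (rule prod.cong[OF refl])
      fix u assume "u \<in> Poly_Mapping.keys m"
      then have "(fst u, snd u) \<in> pluecker_vars ds n" using v[OF m] by auto
      from xy[OF this] show "x u ^ Poly_Mapping.lookup m u = (c (fst u) * y u) ^ Poly_Mapping.lookup m u" by simp
    qed
    also have "\<dots> = (\<Prod>v \<in> Poly_Mapping.keys m. c (fst v) ^ Poly_Mapping.lookup m v) * mon_eval y m"
      by (simp add: power_mult_distrib prod.distrib mon_eval_def)
    also have "(\<Prod>v \<in> Poly_Mapping.keys m. c (fst v) ^ Poly_Mapping.lookup m v) =
        (\<Prod>i<length ds. \<Prod>v \<in> {v \<in> Poly_Mapping.keys m. fst v = i}. c (fst v) ^ Poly_Mapping.lookup m v)"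
      by (rule prod.group[symmetric]) (use v[OF m] in \<open>auto simp: pluecker_vars_def\<close>)
    also have "\<dots> = (\<Prod>i<length ds. c i ^ block_degree i m)"
      by (intro prod.cong) (auto simp: block_degree_def power_sum)
    also have "\<dots> = ?K"
      using e[OF m] by simp
    finally show ?thesis .
  qed
  have "poly_eval x p = ?K * poly_eval y p"
    unfolding poly_eval_def sum_distrib_left by (rule sum.cong) (auto simp: mon)
  then show ?thesis using y by simp
qed

definition coord_sets :: "nat list \<Rightarrow> nat \<Rightarrow> (nat \<Rightarrow> nat set) \<Rightarrow> bool" where
  "coord_sets ds n S \<longleftrightarrow> (\<forall>i<length ds. S i \<subseteq> {..<n} \<and> card (S i) = ds ! i)"

definition minor_eval :: "(nat \<Rightarrow> nat set) \<Rightarrow> (nat \<Rightarrow> 'a::comm_ring_1 mat) \<Rightarrow> 'a mpoly \<Rightarrow> 'a" where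
  "minor_eval S P p = poly_eval (\<lambda>(i, I). minor (P i) I (S i)) p"

lemma pluecker_eval_colspan:
  fixes P :: "nat \<Rightarrow> 'a::field mat"
  assumes p: "multihomogeneous ds n p" and S: "coord_sets ds n S"
    and P: "\<And>i. i < length ds \<Longrightarrow> P i \<in> carrier_mat n n"
    and Ws: "\<And>i. i < length ds \<Longrightarrow> Ws ! i = colspan n (P i) (S i)"
  shows "pluecker_eval ds n Ws p = 0 \<longleftrightarrow> minor_eval S P p = 0"
proof -
  have "\<forall>i<length ds. \<exists>c. \<forall>I \<subseteq> {..<n}. card I = ds ! i \<longrightarrow> pluecker (ds ! i) n (Ws ! i) I = c * minor (P i) I (S i)"
    using pluecker_colspan(1)[OF P] S Ws by (simp add: coord_sets_def)
  then obtain c where c: "\<And>i I. i < length ds \<Longrightarrow> I \<subseteq> {..<n} \<Longrightarrow> card I = ds ! i \<Longrightarrow>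
      pluecker (ds ! i) n (Ws ! i) I = c i * minor (P i) I (S i)"
    by metis
  have "\<forall>i<length ds. \<exists>c. \<forall>I \<subseteq> {..<n}. card I = ds ! i \<longrightarrow> minor (P i) I (S i) = c * pluecker (ds ! i) n (Ws ! i) I"
    using pluecker_colspan(2)[OF P] S Ws by (simp add: coord_sets_def)
  then obtain c' where c': "\<And>i I. i < length ds \<Longrightarrow> I \<subseteq> {..<n} \<Longrightarrow> card I = ds ! i \<Longrightarrow>
      minor (P i) I (S i) = c' i * pluecker (ds ! i) n (Ws ! i) I"
    by metis
  show ?thesis
  proof
    assume "pluecker_eval ds n Ws p = 0"
    then show "minor_eval S P p = 0"
      unfolding pluecker_eval_def minor_eval_def
      by (rule multihomogeneous_scale[OF p, rotated, where c = c']) (auto simp: pluecker_vars_def c')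
  next
    assume "minor_eval S P p = 0"
    then show "pluecker_eval ds n Ws p = 0"
      unfolding pluecker_eval_def minor_eval_def
      by (rule multihomogeneous_scale[OF p, rotated, where c = c]) (auto simp: pluecker_vars_def c)
  qed
qed


section \<open>Density in terms of invertible matrices\<close>

lemma in_listset: "xs \<in> listset As \<longleftrightarrow> length xs = length As \<and> (\<forall>i<length As. xs ! i \<in> As ! i)"
proof (induction As arbitrary: xs)
  case (Cons A As)
  then show ?case
    by (cases xs) (auto simp: set_Cons_def All_less_Suc2)
qed auto

lemma in_Gr_prod: "Ws \<in> Gr_prod ds n \<longleftrightarrow> length Ws = length ds \<and> (\<forall>i<length ds. Ws ! i \<in> Grassmannian (ds ! i) n)"
  by (auto simp: Gr_prod_def in_listset)

definition gl :: "nat \<Rightarrow> 'a::field mat set" where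
  "gl n = {g \<in> carrier_mat n n. det g \<noteq> 0}"

lemma carrier_GL: "carrier (GL n) = gl n"
  by (auto simp: GL_def units_of_def gl_def dest: unit_imp_det_non_zero intro: det_non_zero_imp_unit)
    (simp add: Units_def ring_mat_def)

lemma carrier_PGL: "carrier (PGL n :: 'a::field mat set monoid) = {{c \<cdot>\<^sub>m g | c. c \<noteq> 0} | g. g \<in> gl n}"
proof -
  have *: "(scalar_mats n) #>\<^bsub>GL n\<^esub> g = {c \<cdot>\<^sub>m g | c. c \<noteq> 0}" if "g \<in> gl n" for g :: "'a mat"
  proof -
    have "(c \<cdot>\<^sub>m 1\<^sub>m n) * g = c \<cdot>\<^sub>m g" for c
      using that mult_smult_assoc_mat[of "1\<^sub>m n" n n g n c] left_mult_one_mat[of g n n]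
      by (simp add: gl_def)
    then show ?thesis
      by (auto simp: r_coset_def scalar_mats_def GL_def units_of_def ring_mat_def)
  qed
  show ?thesis
    unfolding PGL_def FactGroup_def RCOSETS_def carrier_GL by (auto simp: * carrier_GL)
qed

lemma PGL_act_colspan:
  assumes g: "g \<in> gl n" and P: "P \<in> carrier_mat n n"
  shows "PGL_act {c \<cdot>\<^sub>m g | c. c \<noteq> 0} (colspan n P S) = colspan n (g * P) S"
proof -
  have gc: "g \<in> carrier_mat n n" using g by (simp add: gl_def)
  have cs: "c \<cdot>\<^sub>v x \<in> coord_space n S" "x \<in> carrier_vec n" if "x \<in> coord_space n S" for c x
    using that by (auto simp: coord_space_def)
  have eq: "(c \<cdot>\<^sub>m g) *\<^sub>v (P *\<^sub>v x) = (g * P) *\<^sub>v (c \<cdot>\<^sub>v x)" if "x \<in> coord_space n S" for c x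
  proof -
    have "(c \<cdot>\<^sub>m g) *\<^sub>v (P *\<^sub>v x) = c \<cdot>\<^sub>v (g *\<^sub>v (P *\<^sub>v x))"
      using gc P by (intro eq_vecI) auto
    then show ?thesis
      using gc P cs(2)[OF that]
      by (simp add: mult_mat_vec[of _ n n] assoc_mult_mat_vec[of _ n n _ n])
  qed
  show ?thesis
  proof (intro equalityI subsetI)
    fix w assume "w \<in> PGL_act {c \<cdot>\<^sub>m g | c. c \<noteq> 0} (colspan n P S)"
    then obtain c x where "x \<in> coord_space n S" "w = (c \<cdot>\<^sub>m g) *\<^sub>v (P *\<^sub>v x)"
      by (auto simp: PGL_act_def colspan_def)
    then show "w \<in> colspan n (g * P) S"
      unfolding colspan_def using eq cs by (metis image_eqI)
  next
    fix w assume "w \<in> colspan n (g * P) S"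
    then obtain x where x: "x \<in> coord_space n S" "w = (g * P) *\<^sub>v x"
      by (auto simp: colspan_def)
    then have "w = (1 \<cdot>\<^sub>m g) *\<^sub>v (P *\<^sub>v x)"
      using eq[OF x(1), of 1] cs(2)[OF x(1)] by simp
    then show "w \<in> PGL_act {c \<cdot>\<^sub>m g | c. c \<noteq> 0} (colspan n P S)"
      using x(1) unfolding PGL_act_def colspan_def by (auto intro!: exI[of _ "1 \<cdot>\<^sub>m g"] exI[of _ "P *\<^sub>v x"] exI[of _ 1])
  qed
qed

definition config :: "nat \<Rightarrow> nat \<Rightarrow> (nat \<Rightarrow> nat set) \<Rightarrow> (nat \<Rightarrow> 'a::field mat) \<Rightarrow> 'a vec set list" where
  "config N n S P = map (\<lambda>i. colspan n (P i) (S i)) [0..<N]"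

lemma gl_mult: "g \<in> gl n \<Longrightarrow> h \<in> gl n \<Longrightarrow> g * h \<in> gl n"
  by (auto simp: gl_def det_mult)

lemma Gr_prod_eq_config:
  assumes S: "coord_sets ds n S"
  shows "Gr_prod ds n = {config (length ds) n S P | P. \<forall>i<length ds. P i \<in> gl n}"
proof (intro equalityI subsetI)
  fix Ws :: "'a vec set list" assume Ws: "Ws \<in> Gr_prod ds n"
  have "\<forall>i<length ds. \<exists>P. P \<in> gl n \<and> Ws ! i = colspan n P (S i)"
  proof (intro allI impI)
    fix i assume i: "i < length ds"
    then have "Ws ! i \<in> Grassmannian (card (S i)) n" "S i \<subseteq> {..<n}"
      using Ws S by (auto simp: in_Gr_prod coord_sets_def)
    from Grassmannian_colspan[OF this] show "\<exists>P. P \<in> gl n \<and> Ws ! i = colspan n P (S i)"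
      by (metis (mono_tags, lifting) gl_def mem_Collect_eq)
  qed
  then obtain P where "\<And>i. i < length ds \<Longrightarrow> P i \<in> gl n \<and> Ws ! i = colspan n (P i) (S i)"
    by metis
  moreover from this have "Ws = config (length ds) n S P"
    using Ws by (intro nth_equalityI) (auto simp: config_def in_Gr_prod)
  ultimately show "Ws \<in> {config (length ds) n S P | P. \<forall>i<length ds. P i \<in> gl n}" by blast
next
  fix Ws :: "'a vec set list"
  assume "Ws \<in> {config (length ds) n S P | P. \<forall>i<length ds. P i \<in> gl n}"
  then obtain P where P: "\<And>i. i < length ds \<Longrightarrow> P i \<in> gl n" "Ws = config (length ds) n S P" by blast
  have "colspan n (P i) (S i) \<in> Grassmannian (ds ! i) n" if "i < length ds" for i
    using colspan_in_Grassmannian[of "P i" n "S i"] P(1)[OF that] S that by (auto simp: gl_def coord_sets_def)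
  then show "Ws \<in> Gr_prod ds n"
    by (simp add: P(2) config_def in_Gr_prod)
qed

lemma orbit_config:
  fixes P :: "nat \<Rightarrow> 'a::field mat"
  assumes P: "\<And>i. i < N \<Longrightarrow> P i \<in> gl n"
  shows "orbit (PGL n) diag_act (config N n S P) = {config N n S (\<lambda>i. g * P i) | g. g \<in> gl n}"
proof -
  have "diag_act {c \<cdot>\<^sub>m g | c. c \<noteq> 0} (config N n S P) = config N n S (\<lambda>i. g * P i)" if "g \<in> gl n" for g
    using P PGL_act_colspan[OF that] by (auto simp: diag_act_def config_def gl_def)
  note act = this
  show ?thesis
    unfolding orbit_def carrier_PGL
  proof (intro equalityI subsetI)
    fix Ws assume "Ws \<in> {config N n S (\<lambda>i. g * P i) | g. g \<in> gl n}"
    then obtain g where g: "g \<in> gl n" "Ws = config N n S (\<lambda>i. g * P i)" by blast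
    then have "Ws = diag_act {c \<cdot>\<^sub>m g | c. c \<noteq> 0} (config N n S P)" by (simp add: act)
    then show "Ws \<in> {diag_act C (config N n S P) | C. C \<in> {{c \<cdot>\<^sub>m g | c. c \<noteq> 0} | g. g \<in> gl n}}"
      using g(1) by blast
  qed (use act in auto)
qed

text \<open>An orbit is dense if and only if every multihomogeneous polynomial that vanishes on it
  vanishes everywhere. With points and group elements written as matrices, this speaks of minors
  of invertible matrices only, and the coordinate sets \<open>S\<close> can be chosen freely.\<close>

theorem dense_iff_minor_eval:
  assumes S: "coord_sets ds n S"
  shows "dense TYPE('a::alg_closed_field) ds n \<longleftrightarrow>
    (\<exists>P. (\<forall>i<length ds. P i \<in> gl n) \<and>
      (\<forall>p. multihomogeneous ds n p \<longrightarrow> (\<forall>g \<in> gl n. minor_eval S (\<lambda>i. g * P i) p = 0) \<longrightarrow>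
        (\<forall>Q. (\<forall>i<length ds. Q i \<in> gl n) \<longrightarrow> minor_eval S Q p = (0::'a))))"
    (is "_ \<longleftrightarrow> (\<exists>P. ?inv P \<and> ?D P)")
proof -
  let ?X = "zariski_topology ds n :: 'a vec set list topology"
  let ?c = "config (length ds) n S :: (nat \<Rightarrow> 'a mat) \<Rightarrow> _"
  have ev: "pluecker_eval ds n (?c Q) p = 0 \<longleftrightarrow> minor_eval S Q p = 0"
    if "?inv Q" "multihomogeneous ds n p" for Q p
    using that by (intro pluecker_eval_colspan[OF _ S]) (auto simp: config_def gl_def)
  have "?X closure_of orbit (PGL n) diag_act (?c P) = Gr_prod ds n \<longleftrightarrow> ?D P" if P: "?inv P" for P
  proof -
    have orb: "orbit (PGL n) diag_act (?c P) = {?c (\<lambda>i. g * P i) | g. g \<in> gl n}"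
      using P by (intro orbit_config) auto
    have gP: "?inv (\<lambda>i. g * P i)" if "g \<in> gl n" for g
      using P that gl_mult by blast
    show ?thesis
    proof (intro iffI allI impI)
      fix p :: "'a mpoly" and Q :: "nat \<Rightarrow> 'a mat"
      assume cl: "?X closure_of orbit (PGL n) diag_act (?c P) = Gr_prod ds n"
        and p: "multihomogeneous ds n p" and van: "\<forall>g \<in> gl n. minor_eval S (\<lambda>i. g * P i) p = 0"
        and Q: "?inv Q"
      show "minor_eval S Q p = 0"
      proof (rule ccontr)
        assume ne: "minor_eval S Q p \<noteq> 0"
        let ?T = "Gr_prod ds n - zero_locus ds n {p}"
        have "openin ?X ?T"
          unfolding openin_zariski using p by (auto simp: zero_locus_def intro!: exI[of _ "{p}"])
        moreover have "?c Q \<in> Gr_prod ds n"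
          using Gr_prod_eq_config[OF S] Q by blast
        moreover from this have "?c Q \<in> ?T"
          using ne ev[OF Q p] by (simp add: zero_locus_def)
        ultimately obtain y where "y \<in> orbit (PGL n) diag_act (?c P)" "y \<in> ?T"
          using cl unfolding closure_of_def by blast
        then obtain g where g: "g \<in> gl n" "?c (\<lambda>i. g * P i) \<in> ?T"
          using orb by auto
        then have "minor_eval S (\<lambda>i. g * P i) p \<noteq> 0"
          using ev[OF gP[OF g(1)] p] by (auto simp: zero_locus_def)
        then show False using van g by blast
      qed
    next
      assume D: "?D P"
      have "Gr_prod ds n \<subseteq> ?X closure_of orbit (PGL n) diag_act (?c P)"
      proof
        fix Xs :: "'a vec set list" assume Xs: "Xs \<in> Gr_prod ds n"
        then obtain Q where Q: "?inv Q" "Xs = ?c Q"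
          using Gr_prod_eq_config[OF S] by blast
        have "\<exists>y \<in> orbit (PGL n) diag_act (?c P). y \<in> T" if T: "Xs \<in> T" "openin ?X T" for T
        proof -
          obtain F where F: "\<forall>p \<in> F. multihomogeneous ds n p" "Gr_prod ds n - T = zero_locus ds n F"
            using T(2) unfolding openin_zariski by blast
          then obtain p where p: "p \<in> F" "pluecker_eval ds n Xs p \<noteq> 0"
            using T(1) Xs unfolding zero_locus_def by blast
          then have mh: "multihomogeneous ds n p" using F by blast
          have "minor_eval S Q p \<noteq> 0" using p(2) ev[OF Q(1) mh] Q(2) by simp
          then obtain g where g: "g \<in> gl n" "minor_eval S (\<lambda>i. g * P i) p \<noteq> 0"
            using D mh Q(1) by blast
          then have "pluecker_eval ds n (?c (\<lambda>i. g * P i)) p \<noteq> 0"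
            using ev[OF gP[OF g(1)] mh] by simp
          moreover have "?c (\<lambda>i. g * P i) \<in> Gr_prod ds n"
            using Gr_prod_eq_config[OF S] gP[OF g(1)] by blast
          ultimately have "?c (\<lambda>i. g * P i) \<in> T"
            using F(2) p(1) unfolding zero_locus_def by blast
          then show ?thesis using orb g(1) by blast
        qed
        then show "Xs \<in> ?X closure_of orbit (PGL n) diag_act (?c P)"
          using Xs by (simp add: closure_of_def topspace_zariski)
      qed
      then show "?X closure_of orbit (PGL n) diag_act (?c P) = Gr_prod ds n"
        using closure_of_subset_topspace[of ?X] by (auto simp: topspace_zariski)
    qed
  qed
  note * = this
  have G: "Ws \<in> Gr_prod ds n \<longleftrightarrow> (\<exists>P. ?inv P \<and> Ws = ?c P)" for Ws :: "'a vec set list"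
    unfolding Gr_prod_eq_config[OF S] by blast
  have "dense TYPE('a) ds n \<longleftrightarrow>
      (\<exists>P. ?inv P \<and> ?X closure_of orbit (PGL n) diag_act (?c P) = Gr_prod ds n)"
    unfolding dense_def Bex_def G by auto
  then show ?thesis
    by (simp add: * cong: conj_cong)
qed

section \<open>Minors of block matrices\<close>

lemma submatrix_carrier:
  assumes "A \<in> carrier_mat n n'" "I \<subseteq> {..<n}" "J \<subseteq> {..<n'}"
  shows "submatrix A I J \<in> carrier_mat (card I) (card J)"
  using assms by (intro carrier_matI) (simp_all add: dim_submatrix card_le_in)

lemma index_submatrix:
  assumes "A \<in> carrier_mat n n'" "I \<subseteq> {..<n}" "J \<subseteq> {..<n'}" "a < card I" "b < card J"
  shows "submatrix A I J $$ (a, b) = A $$ (pick I a, pick J b)"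
  using assms by (simp add: submatrix_index card_le_in)

text \<open>Selecting rows by an arbitrary function either repeats a row, which gives \<open>0\<close>, or
  permutes the rows of an honest minor. The coefficients depend only on the function.\<close>

lemma minor_row_selection:
  fixes f :: "nat \<Rightarrow> nat"
  assumes f: "\<And>a. a < d \<Longrightarrow> f a < n"
  obtains c :: "nat set \<Rightarrow> 'a::comm_ring_1" where
    "\<And>P S. P \<in> carrier_mat n n \<Longrightarrow> S \<subseteq> {..<n} \<Longrightarrow> card S = d \<Longrightarrow>
      det (mat d d (\<lambda>(a, b). P $$ (f a, pick S b))) = (\<Sum>J | J \<subseteq> {..<n} \<and> card J = d. c J * minor P J S)"
proof (cases "inj_on f {..<d}")
  case False
  then obtain a a' where a: "a < d" "a' < d" "a \<noteq> a'" "f a = f a'"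
    by (auto simp: inj_on_def)
  have "det (mat d d (\<lambda>(a, b). P $$ (f a, pick S b))) = 0" for P :: "'a mat" and S
    by (rule det_identical_rows[OF _ a(3,1,2)]) (use a in \<open>auto intro!: eq_vecI\<close>)
  then show thesis
    by (intro that[of "\<lambda>_. 0"]) simp
next
  case True
  define J where "J = f ` {..<d}"
  have J: "J \<subseteq> {..<n}" "card J = d" "finite J"
    using f True by (auto simp: J_def card_image)
  define p where "p a = (if a < d then inv_into {..<d} (pick J) (f a) else a)" for a
  have bp: "bij_betw (pick J) {..<d} J"
    using bij_betw_pick[OF J(3)] J(2) by simp
  have bf: "bij_betw f {..<d} J"
    using True by (simp add: bij_betw_def J_def)
  have "bij_betw (inv_into {..<d} (pick J) \<circ> f) {..<d} {..<d}"
    using bf bij_betw_inv_into[OF bp] by (rule bij_betw_trans)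
  then have "bij_betw p {..<d} {..<d}"
    by (rule bij_betw_cong[THEN iffD1, rotated]) (simp add: p_def)
  then have p: "p permutes {0..<d}"
    by (intro bij_imp_permutes) (auto simp: p_def atLeast0LessThan)
  have fp: "pick J (p a) = f a" if "a < d" for a
    using that f_inv_into_f[of "f a" "pick J" "{..<d}"] bp by (simp add: p_def bij_betw_def J_def)
  have pd: "p a < d" if "a < d" for a
    using permutes_in_image[OF p, of a] that by simp
  have det: "det (mat d d (\<lambda>(a, b). P $$ (f a, pick S b))) = signof p * minor P J S"
    if P: "P \<in> carrier_mat n n" and S: "S \<subseteq> {..<n}" "card S = d" for P :: "'a mat" and S
  proof -
    have M: "submatrix P J S \<in> carrier_mat d d"
      using P S J by (auto simp: dim_submatrix card_le_in)
    have "mat d d (\<lambda>(a, b). P $$ (f a, pick S b)) = mat d d (\<lambda>(a, b). submatrix P J S $$ (p a, b))"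
      using P S J fp pd by (intro eq_matI) (auto simp: submatrix_def card_le_in)
    then show ?thesis
      using det_permute_rows[OF M p] by (simp add: minor_def)
  qed
  have "(\<Sum>J' | J' \<subseteq> {..<n} \<and> card J' = d. (if J' = J then signof p else 0) * minor P J' S) =
      signof p * minor P J S" for P :: "'a mat" and S
  proof -
    have "(\<Sum>J' | J' \<subseteq> {..<n} \<and> card J' = d. (if J' = J then signof p else 0) * minor P J' S) =
      (\<Sum>J' | J' \<subseteq> {..<n} \<and> card J' = d. if J' = J then signof p * minor P J S else 0)"
      by (rule sum.cong) auto
    also have "\<dots> = signof p * minor P J S"
      using J by (subst sum.delta) auto
    finally show ?thesis .
  qed
  then show thesis
    using det by (intro that[of "\<lambda>J'. if J' = J then signof p else 0"]) simp
qed

text \<open>The Cauchy-Binet formula in a form that suffices here: the minors of \<open>h * P\<close> are linear in those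
  of \<open>P\<close>, with coefficients that depend on \<open>h\<close> and the row set only.\<close>

lemma minor_mult_left:
  fixes h :: "'a::comm_ring_1 mat"
  assumes h: "h \<in> carrier_mat n n" and I: "I \<subseteq> {..<n}" "card I = d"
  obtains c where "\<And>P S. P \<in> carrier_mat n n \<Longrightarrow> S \<subseteq> {..<n} \<Longrightarrow> card S = d \<Longrightarrow>
      minor (h * P) I S = (\<Sum>J | J \<subseteq> {..<n} \<and> card J = d. c J * minor P J S)"
proof -
  define F where "F = {f. (\<forall>a \<in> {0..<d}. f a \<in> {0..<n}) \<and> (\<forall>a. a \<notin> {0..<d} \<longrightarrow> f a = a)}"
  let ?JJ = "{J. J \<subseteq> {..<n} \<and> card J = d}"
  have "\<forall>f \<in> F. \<exists>c. \<forall>P S. P \<in> carrier_mat n n \<longrightarrow> S \<subseteq> {..<n} \<longrightarrow> card S = d \<longrightarrow>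
      det (mat d d (\<lambda>(a, b). P $$ (f a, pick S b))) = (\<Sum>J \<in> ?JJ. c J * minor P J S :: 'a)"
  proof
    fix f assume "f \<in> F"
    then have "\<And>a. a < d \<Longrightarrow> f a < n" by (auto simp: F_def)
    then show "\<exists>c. \<forall>P S. P \<in> carrier_mat n n \<longrightarrow> S \<subseteq> {..<n} \<longrightarrow> card S = d \<longrightarrow>
      det (mat d d (\<lambda>(a, b). P $$ (f a, pick S b))) = (\<Sum>J \<in> ?JJ. c J * minor P J S :: 'a)"
    proof (rule minor_row_selection)
      fix c
      assume "\<And>P S. P \<in> carrier_mat n n \<Longrightarrow> S \<subseteq> {..<n} \<Longrightarrow> card S = d \<Longrightarrow>
        det (mat d d (\<lambda>(a, b). P $$ (f a, pick S b))) = (\<Sum>J | J \<subseteq> {..<n} \<and> card J = d. c J * minor P J S :: 'a)"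
      then show ?thesis by (intro exI[of _ c]) simp
    qed
  qed
  from bchoice[OF this] obtain c where
    "\<forall>f \<in> F. \<forall>P S. P \<in> carrier_mat n n \<longrightarrow> S \<subseteq> {..<n} \<longrightarrow> card S = d \<longrightarrow>
      det (mat d d (\<lambda>(a, b). P $$ (f a, pick S b))) = (\<Sum>J \<in> ?JJ. c f J * minor P J S :: 'a)" ..
  then have c: "det (mat d d (\<lambda>(a, b). P $$ (f a, pick S b))) = (\<Sum>J \<in> ?JJ. c f J * minor P J S)"
    if "f \<in> F" "P \<in> carrier_mat n n" "S \<subseteq> {..<n}" "card S = d" for f P S
    using that by simp
  define C where "C J = (\<Sum>f \<in> F. (\<Prod>a \<in> {0..<d}. h $$ (pick I a, f a)) * c f J)" for J
  have "minor (h * P) I S = (\<Sum>J \<in> ?JJ. C J * minor P J S)"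
    if P: "P \<in> carrier_mat n n" and S: "S \<subseteq> {..<n}" "card S = d" for P S
  proof -
    define A where "A = mat d n (\<lambda>(a, l). h $$ (pick I a, l))"
    have A: "A \<in> carrier_mat d n" by (simp add: A_def)
    have pI: "pick I a < n" if "a < d" for a
      using pick_in_set[of a I] that I by auto
    have pS: "pick S a < n" if "a < d" for a
      using pick_in_set[of a S] that S by auto
    define B where "B = colmat n P S"
    have B: "B \<in> carrier_mat n d"
      using colmat_carrier[of n P S] S by (simp add: B_def)
    have "submatrix (h * P) I S = A * B"
    proof (rule eq_matI)
      fix a b assume "a < dim_row (A * B)" "b < dim_col (A * B)"
      then have "a < d" "b < d" using A B by auto
      then show "submatrix (h * P) I S $$ (a, b) = (A * B) $$ (a, b)"
        using P h I S pI pS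
        by (auto simp: submatrix_def card_le_in A_def B_def colmat_def scalar_prod_def intro!: sum.cong)
    qed (use P h I S in \<open>auto simp: dim_submatrix card_le_in A_def B_def colmat_def\<close>)
    then have "minor (h * P) I S = det (A * B)" by (simp add: minor_def)
    also have "\<dots> = (\<Sum>f \<in> F. det (mat\<^sub>r d d (\<lambda>a. A $$ (a, f a) \<cdot>\<^sub>v row B (f a))))"
      unfolding mat_mul_finsum_alt[OF A B] F_def
      by (rule det_linear_rows_sum) (use B in auto)
    also have "\<dots> = (\<Sum>f \<in> F. (\<Prod>a \<in> {0..<d}. h $$ (pick I a, f a)) * (\<Sum>J \<in> ?JJ. c f J * minor P J S))"
    proof (rule sum.cong[OF refl])
      fix f assume f: "f \<in> F"
      then have fn: "\<And>a. a < d \<Longrightarrow> f a < n" by (auto simp: F_def)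
      have "det (mat\<^sub>r d d (\<lambda>a. A $$ (a, f a) \<cdot>\<^sub>v row B (f a))) =
          (\<Prod>a \<in> {0..<d}. A $$ (a, f a)) * det (mat\<^sub>r d d (\<lambda>a. row B (f a)))"
        by (rule det_rows_mul) (use B in auto)
      also have "(\<Prod>a \<in> {0..<d}. A $$ (a, f a)) = (\<Prod>a \<in> {0..<d}. h $$ (pick I a, f a))"
        using fn by (intro prod.cong) (auto simp: A_def)
      also have "mat\<^sub>r d d (\<lambda>a. row B (f a)) = mat d d (\<lambda>(a, b). P $$ (f a, pick S b))"
        using fn S by (intro eq_matI) (auto simp: B_def colmat_def)
      also have "det \<dots> = (\<Sum>J \<in> ?JJ. c f J * minor P J S)"
        by (rule c[OF f P S])
      finally show "det (mat\<^sub>r d d (\<lambda>a. A $$ (a, f a) \<cdot>\<^sub>v row B (f a))) =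
          (\<Prod>a \<in> {0..<d}. h $$ (pick I a, f a)) * (\<Sum>J \<in> ?JJ. c f J * minor P J S)" .
    qed
    also have "\<dots> = (\<Sum>J \<in> ?JJ. C J * minor P J S)"
      unfolding C_def sum_distrib_left sum_distrib_right
      by (subst sum.swap) (simp add: mult.assoc)
    finally show ?thesis .
  qed
  then show thesis
    by (rule that)
qed

text \<open>The embedding of \<open>GL(m)\<close> into \<open>GL(m + k)\<close> that fixes the last \<open>k\<close> unit vectors. It
  also enlarges configurations: for \<open>S \<subseteq> {..<m}\<close> it places the span of the columns in \<open>S\<close>
  into the first \<open>m\<close> coordinates, and for \<open>S \<supseteq> {m..<m + k}\<close> it adds the last \<open>k\<close> unit vectors to
  the span of the columns in \<open>S \<inter> {..<m}\<close>.\<close>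

definition extend_id :: "nat \<Rightarrow> 'a::{zero,one} mat \<Rightarrow> 'a mat" where
  "extend_id k P = four_block_mat P (0\<^sub>m (dim_row P) k) (0\<^sub>m k (dim_col P)) (1\<^sub>m k)"

lemma extend_id_carrier [simp]: "P \<in> carrier_mat m m \<Longrightarrow> extend_id k P \<in> carrier_mat (m + k) (m + k)"
  by (simp add: extend_id_def)

lemma index_extend_id:
  assumes "P \<in> carrier_mat m m" "i < m + k" "j < m + k"
  shows "extend_id k P $$ (i, j) = (if i < m \<and> j < m then P $$ (i, j) else if i = j then 1 else 0)"
  using assms by (auto simp: extend_id_def)

lemma card_split_at: "finite J \<Longrightarrow> card J = card (J \<inter> {..<m}) + card (J \<inter> {m..})" for J :: "nat set"
proof -
  assume J: "finite J"
  have "card J = card ((J \<inter> {..<m}) \<union> (J \<inter> {m..}))"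
    by (rule arg_cong[of _ _ card]) auto
  also have "\<dots> = card (J \<inter> {..<m}) + card (J \<inter> {m..})"
    using J by (intro card_Un_disjoint) auto
  finally show ?thesis .
qed

lemma pick_split:
  assumes J: "finite J" and a: "a < card J"
  shows "pick J a = (if a < card (J \<inter> {..<m}) then pick (J \<inter> {..<m}) a
     else pick (J \<inter> {m..}) (a - card (J \<inter> {..<m})))"
proof (cases "a < card (J \<inter> {..<m})")
  case True
  have eq: "{a. a < m \<and> a \<in> J} = J \<inter> {..<m}" by auto
  show ?thesis
    using True pick_reduce_set[of a m J] unfolding eq by simp
next
  case False
  let ?L = "J \<inter> {..<m}" and ?H = "J \<inter> {m..}"
  have cJ: "card J = card ?L + card ?H"
    using J by (rule card_split_at)
  define b where "b = a - card ?L"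
  have b: "b < card ?H" "a = card ?L + b" using False a cJ by (auto simp: b_def)
  define i where "i = pick ?H b"
  have i: "i \<in> ?H" using pick_in_set[of b ?H] b by (simp add: i_def)
  have "{x \<in> J. x < i} = ?L \<union> {x \<in> ?H. x < i}" using i by auto
  also have "card \<dots> = card ?L + card {x \<in> ?H. x < i}"
    using J by (intro card_Un_disjoint) auto
  also have "card {x \<in> ?H. x < i} = b"
    unfolding i_def by (rule card_pick) (use b in simp)
  finally have "card {x \<in> J. x < i} = a" using b by simp
  then show ?thesis
    using pick_card_in_set[of i J] i False by (simp add: i_def b_def)
qed

lemma det_zero_col:
  fixes A :: "'a::comm_ring_1 mat"
  assumes "A \<in> carrier_mat d d" "j < d" "\<And>i. i < d \<Longrightarrow> A $$ (i, j) = 0"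
  shows "det A = 0"
  using assms by (subst laplace_expansion_column[of A d j]) auto

lemma det_zero_row:
  fixes A :: "'a::comm_ring_1 mat"
  assumes "A \<in> carrier_mat d d" "i < d" "\<And>j. j < d \<Longrightarrow> A $$ (i, j) = 0"
  shows "det A = 0"
  using assms by (subst laplace_expansion_row[of A d i]) auto

text \<open>If the row and column sets agree beyond \<open>m\<close>, the submatrix is block diagonal with an
  identity block; otherwise one of the last \<open>k\<close> rows or columns contributes a zero row or column.\<close>

lemma minor_extend_id:
  fixes P :: "'a::idom mat"
  assumes P: "P \<in> carrier_mat m m"
    and J: "J \<subseteq> {..<m + k}" and S: "S \<subseteq> {..<m + k}" and card: "card J = card S"
  shows "minor (extend_id k P) J S =
    (if J \<inter> {m..} = S \<inter> {m..} then minor P (J \<inter> {..<m}) (S \<inter> {..<m}) else 0)"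
proof -
  let ?X = "submatrix (extend_id k P) J S" and ?d = "card S"
  have fin: "finite J" "finite S" using J S finite_subset by blast+
  have E: "extend_id k P \<in> carrier_mat (m + k) (m + k)" using P by simp
  have X: "?X \<in> carrier_mat ?d ?d"
    using E J S card by (auto simp: dim_submatrix card_le_in)
  have pJ: "pick J a \<in> J" if "a < ?d" for a using pick_in_set[of a J] that card by simp
  have pS: "pick S a \<in> S" if "a < ?d" for a using pick_in_set[of a S] that by simp
  have idx: "?X $$ (a, b) = (if pick J a < m \<and> pick S b < m then P $$ (pick J a, pick S b)
      else if pick J a = pick S b then 1 else 0)" if "a < ?d" "b < ?d" for a b
  proof -
    have "?X $$ (a, b) = extend_id k P $$ (pick J a, pick S b)"
      using E J S card that by (simp add: submatrix_def card_le_in)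
    moreover have "pick J a < m + k" "pick S b < m + k"
      using pJ[OF that(1)] pS[OF that(2)] J S by auto
    ultimately show ?thesis
      by (simp add: index_extend_id[OF P])
  qed
  show ?thesis
  proof (cases "J \<inter> {m..} = S \<inter> {m..}")
    case False
    then consider l where "l \<in> J" "l \<ge> m" "l \<notin> S" | l where "l \<in> S" "l \<ge> m" "l \<notin> J" by auto
    then have "det ?X = 0"
    proof cases
      case 1
      obtain a where a: "a < ?d" "pick J a = l"
        using bij_betw_imp_surj_on[OF bij_betw_pick[OF fin(1)]] 1(1) card by force
      show ?thesis
      proof (rule det_zero_row[OF X a(1)])
        fix b assume b: "b < ?d"
        show "?X $$ (a, b) = 0" using idx[OF a(1) b] a(2) 1 pS[OF b] by auto
      qed
    next
      case 2
      obtain b where b: "b < ?d" "pick S b = l"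
        using bij_betw_imp_surj_on[OF bij_betw_pick[OF fin(2)]] 2(1) by force
      show ?thesis
      proof (rule det_zero_col[OF X b(1)])
        fix a assume a: "a < ?d"
        show "?X $$ (a, b) = 0" using idx[OF a b(1)] b(2) 2 pJ[OF a] by auto
      qed
    qed
    then show ?thesis using False by (simp add: minor_def)
  next
    case True
    let ?J' = "J \<inter> {..<m}" and ?S' = "S \<inter> {..<m}" and ?T = "S \<inter> {m..}"
    have cJ: "card J = card ?J' + card ?T"
      using card_split_at[OF fin(1), of m] True by simp
    have cS: "card S = card ?S' + card ?T"
      using fin(2) by (rule card_split_at)
    define e where "e = card ?S'"
    define t where "t = card ?T"
    have e': "card ?J' = e" using cJ cS card by (simp add: e_def)
    have dd: "?d = e + t" using cS by (simp add: e_def t_def)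
    have pickJ: "pick J a = (if a < e then pick ?J' a else pick ?T (a - e))" if "a < ?d" for a
      using pick_split[OF fin(1), of a m] that card True e' by simp
    have pickS: "pick S a = (if a < e then pick ?S' a else pick ?T (a - e))" if "a < ?d" for a
      using pick_split[OF fin(2), of a m] that by (simp add: e_def)
    have pJ': "pick ?J' a < m" if "a < e" for a using pick_in_set[of a ?J'] that e' by simp
    have pS': "pick ?S' a < m" if "a < e" for a using pick_in_set[of a ?S'] that by (simp add: e_def)
    have pT: "pick ?T a \<ge> m" if "a < t" for a using pick_in_set[of a ?T] that by (simp add: t_def)
    have pT_inj: "pick ?T a = pick ?T b \<longleftrightarrow> a = b" if "a < t" "b < t" for a b
      using bij_betw_pick[of ?T] fin that by (auto simp: bij_betw_def inj_on_def t_def)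
    have X': "submatrix P ?J' ?S' \<in> carrier_mat e e"
      using submatrix_carrier[OF P, of ?J' ?S'] e' by (simp add: e_def)
    have "?X = four_block_mat (submatrix P ?J' ?S') (0\<^sub>m e t) (0\<^sub>m t e) (1\<^sub>m t)"
    proof (rule eq_matI)
      fix a b
      assume "a < dim_row (four_block_mat (submatrix P ?J' ?S') (0\<^sub>m e t) (0\<^sub>m t e) (1\<^sub>m t))"
        "b < dim_col (four_block_mat (submatrix P ?J' ?S') (0\<^sub>m e t) (0\<^sub>m t e) (1\<^sub>m t))"
      then have ab: "a < e + t" "b < e + t" using X' by auto
      have sub: "submatrix P ?J' ?S' $$ (a, b) = P $$ (pick ?J' a, pick ?S' b)" if "a < e" "b < e"
        using index_submatrix[OF P, of ?J' ?S' a b] that e' by (simp add: e_def)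
      show "?X $$ (a, b) = four_block_mat (submatrix P ?J' ?S') (0\<^sub>m e t) (0\<^sub>m t e) (1\<^sub>m t) $$ (a, b)"
      proof -
        have na: "\<not> pick ?T (a - e) < m" if "\<not> a < e"
        proof -
          have "a - e < t" using ab that by linarith
          then show ?thesis using pT[of "a - e"] by simp
        qed
        have nb: "\<not> pick ?T (b - e) < m" if "\<not> b < e"
        proof -
          have "b - e < t" using ab that by linarith
          then show ?thesis using pT[of "b - e"] by simp
        qed
        consider "a < e" "b < e" | "a < e" "\<not> b < e" | "\<not> a < e" "b < e" | "\<not> a < e" "\<not> b < e" by blast
        then show ?thesis
        proof cases
          case 1
        then show ?thesis
          using ab X' idx[of a b] pickJ[of a] pickS[of b] pJ'[of a] pS'[of b] sub by (simp add: dd)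
      next
        case 2
        then show ?thesis
          using ab X' idx[of a b] pickJ[of a] pickS[of b] pJ'[of a] nb by (simp add: dd)
      next
        case 3
        then show ?thesis
          using ab X' idx[of a b] pickJ[of a] pickS[of b] pS'[of b] na by (simp add: dd)
      next
        case 4
        then show ?thesis
          using ab X' idx[of a b] pickJ[of a] pickS[of b] na nb
            pT_inj[of "a - e" "b - e"] by (auto simp add: dd)
        qed
      qed
    qed (use X X' dd in auto)
    then have "det ?X = det (submatrix P ?J' ?S') * det (1\<^sub>m t :: 'a mat)"
      using det_four_block_mat_upper_right_zero[OF X' refl, of "0\<^sub>m t e" t "1\<^sub>m t"] by simp
    then show ?thesis using True by (simp add: minor_def)
  qed
qed

lemma minor_mult_extend_id:
  fixes h :: "'a::idom mat"
  assumes h: "h \<in> carrier_mat (m + k) (m + k)" and S: "S \<subseteq> {..<m + k}"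
    and I: "I \<subseteq> {..<m + k}" "card I = card S"
  obtains c where "\<And>P. P \<in> carrier_mat m m \<Longrightarrow> minor (h * extend_id k P) I S =
      (\<Sum>J | J \<subseteq> {..<m} \<and> card J = card (S \<inter> {..<m}). c J * minor P J (S \<inter> {..<m}))"
proof -
  have fS: "finite S" using S finite_subset by blast
  let ?T = "S \<inter> {m..}" and ?S' = "S \<inter> {..<m}"
  obtain c where c: "\<And>P. P \<in> carrier_mat (m + k) (m + k) \<Longrightarrow>
      minor (h * P) I S = (\<Sum>J | J \<subseteq> {..<m + k} \<and> card J = card S. c J * minor P J S)"
    by (rule minor_mult_left[OF h I]) (use S in blast)
  have cS: "card S = card ?S' + card ?T"
    using fS by (rule card_split_at)
  let ?A = "{J. J \<subseteq> {..<m + k} \<and> card J = card S}" and ?B = "{J. J \<subseteq> {..<m} \<and> card J = card ?S'}"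
  have fA: "finite ?A" by (rule finite_subset[of _ "Pow {..<m + k}"]) auto
  have cU: "card (J \<union> ?T) = card S" if "J \<in> ?B" for J
  proof -
    have "card (J \<union> ?T) = card J + card ?T"
      using that fS by (intro card_Un_disjoint) (auto intro: finite_subset)
    then show ?thesis using that cS by simp
  qed
  have BA: "(\<lambda>J. J \<union> ?T) ` ?B \<subseteq> ?A"
  proof (rule image_subsetI)
    fix J assume J: "J \<in> ?B"
    then have "J \<subseteq> {..<m + k}" by auto
    then show "J \<union> ?T \<in> ?A" using cU[OF J] S by auto
  qed
  have inj: "inj_on (\<lambda>J. J \<union> ?T) ?B"
    by (rule inj_on_inverseI[of _ "\<lambda>J. J \<inter> {..<m}"]) auto
  have zero: "minor (extend_id k P) J S = 0"
    if P: "P \<in> carrier_mat m m" and J: "J \<in> ?A" "J \<notin> (\<lambda>J. J \<union> ?T) ` ?B" for P :: "'a mat" and J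
  proof -
    have "J \<inter> {m..} \<noteq> ?T"
    proof
      assume T: "J \<inter> {m..} = ?T"
      have fJ: "finite J" using J(1) finite_subset[of J "{..<m + k}"] by auto
      have "card J = card (J \<inter> {..<m}) + card ?T"
        using card_split_at[OF fJ, of m] T by simp
      then have "J \<inter> {..<m} \<in> ?B" using J(1) cS by simp
      moreover have "J = (J \<inter> {..<m}) \<union> ?T" unfolding T[symmetric] by auto
      ultimately show False using J(2) by (metis (no_types, lifting) imageI)
    qed
    then show ?thesis
      using J(1) minor_extend_id[OF P _ S, of J] by simp
  qed
  have "minor (h * extend_id k P) I S = (\<Sum>J \<in> ?B. c (J \<union> ?T) * minor P J ?S')"
    if P: "P \<in> carrier_mat m m" for P
  proof -
    have "minor (h * extend_id k P) I S = (\<Sum>J \<in> ?A. c J * minor (extend_id k P) J S)"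
      by (rule c) (simp add: P)
    also have "\<dots> = (\<Sum>J \<in> (\<lambda>J. J \<union> ?T) ` ?B. c J * minor (extend_id k P) J S)"
      using zero[OF P] by (intro sum.mono_neutral_right[OF fA BA]) auto
    also have "\<dots> = (\<Sum>J \<in> ?B. c (J \<union> ?T) * minor (extend_id k P) (J \<union> ?T) S)"
      by (subst sum.reindex[OF inj]) simp
    also have "\<dots> = (\<Sum>J \<in> ?B. c (J \<union> ?T) * minor P J ?S')"
    proof (rule sum.cong[OF refl])
      fix J assume J: "J \<in> ?B"
      have "J \<union> ?T \<subseteq> {..<m + k}" using J S by auto
      moreover have "(J \<union> ?T) \<inter> {m..} = ?T" "(J \<union> ?T) \<inter> {..<m} = J" using J by auto
      ultimately show "c (J \<union> ?T) * minor (extend_id k P) (J \<union> ?T) S = c (J \<union> ?T) * minor P J ?S'"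
        using minor_extend_id[OF P _ S, of "J \<union> ?T"] cU[OF J] by simp
    qed
    finally show ?thesis .
  qed
  then show thesis by (rule that)
qed

section \<open>Substitution in multihomogeneous polynomials\<close>

definition homogeneous_of_degree :: "nat list \<Rightarrow> nat \<Rightarrow> (nat \<Rightarrow> nat) \<Rightarrow> 'a::field mpoly \<Rightarrow> bool" where
  "homogeneous_of_degree ds n e p \<longleftrightarrow> (\<forall>m \<in> Poly_Mapping.keys p.
     Poly_Mapping.keys m \<subseteq> pluecker_vars ds n \<and> (\<forall>i < length ds. block_degree i m = e i))"

lemma multihomogeneous_iff: "multihomogeneous ds n p \<longleftrightarrow> (\<exists>e. homogeneous_of_degree ds n e p)"
  by (auto simp: multihomogeneous_def homogeneous_of_degree_def)

lemma homogeneous_of_degree_add: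
  "homogeneous_of_degree ds n e p \<Longrightarrow> homogeneous_of_degree ds n e q \<Longrightarrow> homogeneous_of_degree ds n e (p + q)"
  unfolding homogeneous_of_degree_def using Poly_Mapping.keys_add[of p q] by blast

lemma homogeneous_of_degree_sum:
  "(\<And>a. a \<in> A \<Longrightarrow> homogeneous_of_degree ds n e (f a)) \<Longrightarrow> homogeneous_of_degree ds n e (sum f A)"
  by (induction A rule: infinite_finite_induct)
    (auto intro: homogeneous_of_degree_add, auto simp: homogeneous_of_degree_def)

lemma homogeneous_of_degree_mult:
  assumes p: "homogeneous_of_degree ds n e p" and q: "homogeneous_of_degree ds n e' q"
  shows "homogeneous_of_degree ds n (\<lambda>i. e i + e' i) (p * q)"
  unfolding homogeneous_of_degree_def
proof
  fix m assume "m \<in> Poly_Mapping.keys (p * q)"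
  then obtain a b where ab: "m = a + b" "a \<in> Poly_Mapping.keys p" "b \<in> Poly_Mapping.keys q"
    using keys_mult[of p q] by auto
  have "Poly_Mapping.keys m \<subseteq> pluecker_vars ds n"
    using ab p q Poly_Mapping.keys_add[of a b] unfolding homogeneous_of_degree_def by blast
  then show "Poly_Mapping.keys m \<subseteq> pluecker_vars ds n \<and> (\<forall>i<length ds. block_degree i m = e i + e' i)"
    using ab p q by (simp add: homogeneous_of_degree_def block_degree_add)
qed

lemma homogeneous_of_degree_const: "homogeneous_of_degree ds n (\<lambda>_. 0) (Poly_Mapping.single 0 c)"
  by (auto simp: homogeneous_of_degree_def block_degree_def)

lemma homogeneous_of_degree_one: "homogeneous_of_degree ds n (\<lambda>_. 0) 1"
  using homogeneous_of_degree_const[of ds n 1] by (simp add: single_one)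

lemma homogeneous_of_degree_var:
  assumes "i < length ds" "J \<subseteq> {..<n}" "card J = ds ! i"
  shows "homogeneous_of_degree ds n (\<lambda>j. if j = i then 1 else 0)
    (Poly_Mapping.single (Poly_Mapping.single (i, J) (Suc 0)) c)"
proof -
  have "{v \<in> {(i, J)}. fst v = j} = (if j = i then {(i, J)} else {})" for j by auto
  then show ?thesis
    using assms by (simp add: homogeneous_of_degree_def block_degree_def pluecker_vars_def)
qed

lemma homogeneous_of_degree_power:
  "homogeneous_of_degree ds n e p \<Longrightarrow> homogeneous_of_degree ds n (\<lambda>i. j * e i) (p ^ j)"
proof (induction j)
  case (Suc j)
  then show ?case
    using homogeneous_of_degree_mult[of ds n e p "\<lambda>i. j * e i" "p ^ j"] by (simp add: add.commute)
qed (simp add: homogeneous_of_degree_one)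

lemma homogeneous_of_degree_prod:
  "(\<And>a. a \<in> A \<Longrightarrow> homogeneous_of_degree ds n (e a) (f a)) \<Longrightarrow>
    homogeneous_of_degree ds n (\<lambda>i. \<Sum>a \<in> A. e a i) (prod f A)"
proof (induction A rule: infinite_finite_induct)
  case (insert a A)
  then show ?case
    using homogeneous_of_degree_mult[of ds n "e a" "f a" "\<lambda>i. \<Sum>a \<in> A. e a i" "prod f A"] by simp
qed (simp_all add: homogeneous_of_degree_one)

lemma poly_eval_one [simp]: "poly_eval x 1 = 1"
  using poly_eval_single[of x 0 1] by (simp add: single_one mon_eval_def)

lemma poly_eval_power: "poly_eval x (p ^ j) = poly_eval x p ^ j"
  by (induction j) (simp_all add: poly_eval_mult)

lemma poly_eval_prod: "poly_eval x (prod f A) = (\<Prod>a \<in> A. poly_eval x (f a))"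
  by (induction A rule: infinite_finite_induct) (simp_all add: poly_eval_mult)

definition subst_vars :: "('v \<Rightarrow> ('w \<Rightarrow>\<^sub>0 nat) \<Rightarrow>\<^sub>0 'a) \<Rightarrow> (('v \<Rightarrow>\<^sub>0 nat) \<Rightarrow>\<^sub>0 'a::comm_semiring_1) \<Rightarrow> ('w \<Rightarrow>\<^sub>0 nat) \<Rightarrow>\<^sub>0 'a" where
  "subst_vars L p = (\<Sum>m \<in> Poly_Mapping.keys p. Poly_Mapping.single 0 (Poly_Mapping.lookup p m) *
     (\<Prod>v \<in> Poly_Mapping.keys m. L v ^ Poly_Mapping.lookup m v))"

lemma poly_eval_subst_vars: "poly_eval x (subst_vars L p) = poly_eval (\<lambda>v. poly_eval x (L v)) p"
proof -
  have [simp]: "mon_eval x 0 = 1" by (simp add: mon_eval_def)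
  show ?thesis
    by (simp add: subst_vars_def poly_eval_sum poly_eval_mult poly_eval_prod poly_eval_power
      poly_eval_def[of _ p] mon_eval_def[of "\<lambda>v. poly_eval x (L v)"])
qed

lemma multihomogeneous_subst_vars:
  assumes p: "multihomogeneous ds n p" and len: "length ds' = length ds"
    and L: "\<And>i I. (i, I) \<in> pluecker_vars ds n \<Longrightarrow>
      homogeneous_of_degree ds' n' (\<lambda>j. if j = i then 1 else 0) (L (i, I))"
  shows "multihomogeneous ds' n' (subst_vars L p)"
proof -
  obtain e where p: "homogeneous_of_degree ds n e p"
    using p by (auto simp: multihomogeneous_iff)
  have "homogeneous_of_degree ds' n' e (Poly_Mapping.single 0 (Poly_Mapping.lookup p m) *
     (\<Prod>v \<in> Poly_Mapping.keys m. L v ^ Poly_Mapping.lookup m v))" if m: "m \<in> Poly_Mapping.keys p" for m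
  proof -
    let ?e = "\<lambda>j. 0 + (\<Sum>v \<in> Poly_Mapping.keys m. Poly_Mapping.lookup m v * (if j = fst v then 1 else 0))"
    have keys: "Poly_Mapping.keys m \<subseteq> pluecker_vars ds n"
      using p m by (simp add: homogeneous_of_degree_def)
    have "homogeneous_of_degree ds' n' ?e (Poly_Mapping.single 0 (Poly_Mapping.lookup p m) *
       (\<Prod>v \<in> Poly_Mapping.keys m. L v ^ Poly_Mapping.lookup m v))"
    proof (intro homogeneous_of_degree_mult homogeneous_of_degree_const homogeneous_of_degree_prod
        homogeneous_of_degree_power)
      fix v assume "v \<in> Poly_Mapping.keys m"
      then have "(fst v, snd v) \<in> pluecker_vars ds n" using keys by auto
      from L[OF this] show "homogeneous_of_degree ds' n' (\<lambda>j. if j = fst v then 1 else 0) (L v)"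
        by simp
    qed
    moreover have "?e j = e j" if "j < length ds" for j
    proof -
      have "?e j = (\<Sum>v \<in> Poly_Mapping.keys m. if fst v = j then Poly_Mapping.lookup m v else 0)"
        by (auto intro!: sum.cong)
      also have "\<dots> = block_degree j m"
        unfolding block_degree_def by (subst sum.inter_filter) auto
      also have "\<dots> = e j" using p m that by (simp add: homogeneous_of_degree_def)
      finally show ?thesis .
    qed
    ultimately show ?thesis
      using len by (simp add: homogeneous_of_degree_def)
  qed
  then have "homogeneous_of_degree ds' n' e (subst_vars L p)"
    unfolding subst_vars_def by (intro homogeneous_of_degree_sum)
  then show ?thesis
    by (auto simp: multihomogeneous_iff)
qed

lemma poly_eval_cong:
  assumes p: "multihomogeneous ds n p"
    and xy: "\<And>i I. (i, I) \<in> pluecker_vars ds n \<Longrightarrow> x (i, I) = y (i, I)"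
  shows "poly_eval x p = poly_eval y p"
proof -
  have "mon_eval x m = mon_eval y m" if "m \<in> Poly_Mapping.keys p" for m
    unfolding mon_eval_def
  proof (rule prod.cong[OF refl])
    fix v assume "v \<in> Poly_Mapping.keys m"
    then have "(fst v, snd v) \<in> pluecker_vars ds n"
      using p that by (auto simp: multihomogeneous_def)
    from xy[OF this] show "x v ^ Poly_Mapping.lookup m v = y v ^ Poly_Mapping.lookup m v" by simp
  qed
  then show ?thesis by (simp add: poly_eval_def)
qed

text \<open>For fixed \<open>h\<close>, the Pluecker coordinates of the enlarged and moved configuration are linear forms in
  those of the small one, factor by factor. Substituting them preserves
  multihomogeneity, and the result can be tested against a dense orbit of small
  configurations.\<close>

lemma minor_eval_mult_extend_id:
  fixes h :: "'a::field mat"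
  assumes S: "coord_sets ds (m + k) S" and S': "coord_sets ds' m (\<lambda>i. S i \<inter> {..<m})"
    and len: "length ds' = length ds"
    and h: "h \<in> carrier_mat (m + k) (m + k)" and p: "multihomogeneous ds (m + k) p"
  shows "\<exists>p'. multihomogeneous ds' m p' \<and> (\<forall>P. (\<forall>i<length ds. P i \<in> carrier_mat m m) \<longrightarrow>
    minor_eval (\<lambda>i. S i \<inter> {..<m}) P p' = minor_eval S (\<lambda>i. h * extend_id k (P i)) p)"
proof -
  let ?JJ = "\<lambda>i. {J. J \<subseteq> {..<m} \<and> card J = ds' ! i}"
  have "\<forall>v \<in> pluecker_vars ds (m + k). \<exists>c. \<forall>P. P \<in> carrier_mat m m \<longrightarrow>
      minor (h * extend_id k P) (snd v) (S (fst v)) = (\<Sum>J \<in> ?JJ (fst v). c J * minor P J (S (fst v) \<inter> {..<m}))"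
  proof
    fix v assume v: "v \<in> pluecker_vars ds (m + k)"
    then obtain i I where "v = (i, I)" "i < length ds" "I \<subseteq> {..<m + k}" "card I = ds ! i"
      by (auto simp: pluecker_vars_def)
    then have *: "S (fst v) \<subseteq> {..<m + k}" "snd v \<subseteq> {..<m + k}" "card (snd v) = card (S (fst v))"
      "card (S (fst v) \<inter> {..<m}) = ds' ! fst v"
      using S S' len by (simp_all add: coord_sets_def)
    show "\<exists>c. \<forall>P. P \<in> carrier_mat m m \<longrightarrow>
      minor (h * extend_id k P) (snd v) (S (fst v)) = (\<Sum>J \<in> ?JJ (fst v). c J * minor P J (S (fst v) \<inter> {..<m}))"
    proof (rule minor_mult_extend_id[OF h *(1-3)])
      fix c assume "\<And>P. P \<in> carrier_mat m m \<Longrightarrow> minor (h * extend_id k P) (snd v) (S (fst v)) =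
        (\<Sum>J | J \<subseteq> {..<m} \<and> card J = card (S (fst v) \<inter> {..<m}). c J * minor P J (S (fst v) \<inter> {..<m}))"
      then show ?thesis by (intro exI[of _ c]) (simp add: *(4))
    qed
  qed
  from bchoice[OF this] obtain c where c: "\<forall>v \<in> pluecker_vars ds (m + k). \<forall>P. P \<in> carrier_mat m m \<longrightarrow>
      minor (h * extend_id k P) (snd v) (S (fst v)) = (\<Sum>J \<in> ?JJ (fst v). c v J * minor P J (S (fst v) \<inter> {..<m}))" ..
  define L where "L v = (\<Sum>J \<in> ?JJ (fst v). Poly_Mapping.single (Poly_Mapping.single (fst v, J) (1::nat)) (c v J))" for v
  have "multihomogeneous ds' m (subst_vars L p)"
  proof (rule multihomogeneous_subst_vars[OF p len])
    fix i I assume "(i, I) \<in> pluecker_vars ds (m + k)"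
    then have "i < length ds'" using len by (simp add: pluecker_vars_def)
    then show "homogeneous_of_degree ds' m (\<lambda>j. if j = i then 1 else 0) (L (i, I))"
      unfolding L_def by (auto intro!: homogeneous_of_degree_sum homogeneous_of_degree_var)
  qed
  moreover have "minor_eval (\<lambda>i. S i \<inter> {..<m}) P (subst_vars L p) = minor_eval S (\<lambda>i. h * extend_id k (P i)) p"
    if P: "\<forall>i<length ds. P i \<in> carrier_mat m m" for P
    unfolding minor_eval_def poly_eval_subst_vars
  proof (rule poly_eval_cong[OF p])
    fix i I assume v: "(i, I) \<in> pluecker_vars ds (m + k)"
    then have "P i \<in> carrier_mat m m" using P by (simp add: pluecker_vars_def)
    then show "poly_eval (\<lambda>(i, I). minor (P i) I (S i \<inter> {..<m})) (L (i, I)) =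
      (case (i, I) of (i, I) \<Rightarrow> minor (h * extend_id k (P i)) I (S i))"
      using c v by (force simp: L_def poly_eval_sum mon_eval_def intro!: sum.cong)
  qed
  ultimately show ?thesis by blast
qed

section \<open>One-parameter families of matrices\<close>

text \<open>Over a finite field, \<open>1 + \<Prod>(x - a)\<close> would have no root.\<close>

lemma infinite_alg_closed: "infinite (UNIV :: 'a::alg_closed_field set)"
proof
  assume fin: "finite (UNIV :: 'a set)"
  let ?p = "1 + (\<Prod>a \<in> (UNIV :: 'a set). [:- a, 1:])"
  have "degree (\<Prod>a \<in> (UNIV :: 'a set). [:- a, 1:]) = card (UNIV :: 'a set)"
    by (subst degree_prod_sum_eq) auto
  then have "degree ?p > 0"
    using fin by (subst degree_add_eq_right) (auto simp: card_gt_0_iff)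
  then obtain x where "poly ?p x = 0"
    using alg_closed_imp_poly_has_root by blast
  moreover have "poly (\<Prod>a \<in> (UNIV :: 'a set). [:- a, 1:]) x = 0"
    using fin by (auto simp: poly_prod)
  ultimately show False by simp
qed

lemma poly_eq_0_if_generically_0:
  fixes f q :: "'a::idom poly"
  assumes inf: "infinite (UNIV :: 'a set)" and q: "q \<noteq> 0"
    and f: "\<And>t. poly q t \<noteq> 0 \<Longrightarrow> poly f t = 0"
  shows "f = 0"
proof -
  have "{t. poly (f * q) t = 0} = UNIV" using f by auto
  then have "f * q = 0" using inf poly_roots_finite[of "f * q"] by auto
  then show ?thesis using q by simp
qed

abbreviation eval_mat :: "'a \<Rightarrow> 'a::comm_ring_1 poly mat \<Rightarrow> 'a mat" where
  "eval_mat t \<equiv> map_mat (\<lambda>f. poly f t)"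

lemma comm_ring_hom_poly: "comm_ring_hom (\<lambda>f. poly f t)"
  by unfold_locales auto

lemma eval_mat_mult: "A \<in> carrier_mat a b \<Longrightarrow> B \<in> carrier_mat b c \<Longrightarrow>
    eval_mat t (A * B) = eval_mat t A * eval_mat t B"
proof -
  interpret comm_ring_hom "\<lambda>f. poly f t" by (rule comm_ring_hom_poly)
  show "A \<in> carrier_mat a b \<Longrightarrow> B \<in> carrier_mat b c \<Longrightarrow> ?thesis" by (rule mat_hom_mult)
qed

lemma det_eval_mat: "det (eval_mat t A) = poly (det A) t"
proof -
  interpret comm_ring_hom "\<lambda>f. poly f t" by (rule comm_ring_hom_poly)
  show ?thesis by (rule hom_det)
qed

lemma eval_mat_smult_one: "eval_mat t (c \<cdot>\<^sub>m 1\<^sub>m n) = poly c t \<cdot>\<^sub>m 1\<^sub>m n"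
  by (rule eq_matI) auto

lemma eval_mat_adj_mat_one:
  assumes X: "X \<in> carrier_mat n n" and one: "eval_mat t X = 1\<^sub>m n"
  shows "eval_mat t (adj_mat X) = 1\<^sub>m n"
proof -
  have "eval_mat t (adj_mat X) = eval_mat t X * eval_mat t (adj_mat X)"
    using adj_mat(1)[OF X] by (simp add: one left_mult_one_mat[of _ n n])
  also have "\<dots> = eval_mat t (det X \<cdot>\<^sub>m 1\<^sub>m n)"
    using eval_mat_mult[OF X adj_mat(1)[OF X], of t] adj_mat(2)[OF X] by simp
  also have "\<dots> = 1\<^sub>m n"
    using det_eval_mat[of t X] one by (intro eq_matI) (auto simp: eval_mat_smult_one)
  finally show ?thesis .
qed

lemma minor_eval_mat:
  assumes "X \<in> carrier_mat n n" "I \<subseteq> {..<n}" "S \<subseteq> {..<n}"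
  shows "minor (eval_mat t X) I S = poly (minor X I S) t"
proof -
  have "submatrix (eval_mat t X) I S = eval_mat t (submatrix X I S)"
  proof (rule eq_matI)
    fix a b assume "a < dim_row (eval_mat t (submatrix X I S))" "b < dim_col (eval_mat t (submatrix X I S))"
    then have ab: "a < card I" "b < card S" using submatrix_carrier[OF assms] by auto
    then have "pick I a < n" "pick S b < n"
      using assms pick_in_set[of a I] pick_in_set[of b S] by auto
    then show "submatrix (eval_mat t X) I S $$ (a, b) = eval_mat t (submatrix X I S) $$ (a, b)"
      using ab assms submatrix_carrier[OF assms] index_submatrix[OF assms ab]
        index_submatrix[of "eval_mat t X" n n I S a b] by simp
  qed (use assms submatrix_carrier[of "eval_mat t X" n n I S] submatrix_carrier[OF assms] in auto)
  then show ?thesis by (simp add: minor_def det_eval_mat)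
qed

lemma poly_mon_eval: "poly (mon_eval x m) t = mon_eval (\<lambda>v. poly (x v) t) m"
  by (simp add: mon_eval_def poly_prod)

text \<open>Along a family of matrices with polynomial entries, \<open>minor_eval\<close> is a polynomial in the parameter.
  If it vanishes wherever \<open>q\<close> does not, it has infinitely many zeros.\<close>

lemma minor_eval_eq_0_if_generically_0:
  fixes X :: "nat \<Rightarrow> 'a::field poly mat"
  assumes inf: "infinite (UNIV :: 'a set)"
    and p: "multihomogeneous ds n p" and S: "coord_sets ds n S"
    and X: "\<And>i. i < length ds \<Longrightarrow> X i \<in> carrier_mat n n"
    and q: "q \<noteq> 0" and gen: "\<And>t. poly q t \<noteq> 0 \<Longrightarrow> minor_eval S (\<lambda>i. eval_mat t (X i)) p = 0"
  shows "minor_eval S (\<lambda>i. eval_mat t (X i)) p = 0"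
proof -
  define f where "f = (\<Sum>m \<in> Poly_Mapping.keys p.
    Polynomial.smult (Poly_Mapping.lookup p m) (mon_eval (\<lambda>(i, I). minor (X i) I (S i)) m))"
  have f: "poly f t = minor_eval S (\<lambda>i. eval_mat t (X i)) p" for t
  proof -
    have "poly f t = poly_eval (\<lambda>v. poly (case v of (i, I) \<Rightarrow> minor (X i) I (S i)) t) p"
      by (simp add: f_def poly_sum poly_mon_eval poly_eval_def)
    also have "\<dots> = minor_eval S (\<lambda>i. eval_mat t (X i)) p"
      unfolding minor_eval_def
      by (rule poly_eval_cong[OF p])
        (use X S in \<open>auto simp: pluecker_vars_def coord_sets_def minor_eval_mat[of _ n]\<close>)
    finally show ?thesis .
  qed
  have "f = 0"
    by (rule poly_eq_0_if_generically_0[OF inf q]) (simp add: f gen)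
  then show ?thesis using f[of t] by simp
qed

section \<open>Splitting a generic configuration\<close>

lemma gl_inverse:
  assumes P: "P \<in> gl n"
  obtains P' where "P' \<in> gl n" "P * P' = 1\<^sub>m n" "P' * P = 1\<^sub>m n"
proof -
  have Pc: "P \<in> carrier_mat n n" and d: "det P \<noteq> 0" using P by (auto simp: gl_def)
  from det_non_zero_imp_unit[OF Pc d, of "()"]
  obtain P' where P': "P' \<in> carrier_mat n n" "P * P' = 1\<^sub>m n" "P' * P = 1\<^sub>m n"
    by (auto simp: Units_def ring_mat_def)
  have "det P * det P' = 1" using det_mult[OF Pc P'(1)] P'(2) by simp
  then have "P' \<in> gl n" using P'(1) by (auto simp: gl_def)
  then show thesis using that P' by blast
qed

lemma extend_id_mult:
  assumes A: "A \<in> carrier_mat m m" and B: "B \<in> carrier_mat m m"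
  shows "extend_id k (A * B) = extend_id k A * extend_id k (B :: 'a::comm_ring_1 mat)"
proof -
  have "extend_id k A * extend_id k B = four_block_mat (A * B + 0\<^sub>m m k * 0\<^sub>m k m)
      (A * 0\<^sub>m m k + 0\<^sub>m m k * 1\<^sub>m k) (0\<^sub>m k m * B + 1\<^sub>m k * 0\<^sub>m k m) (0\<^sub>m k m * 0\<^sub>m m k + 1\<^sub>m k * 1\<^sub>m k)"
    using A B unfolding extend_id_def by (subst mult_four_block_mat[of _ m m _ k _ k _ _ m _ k]) auto
  then show ?thesis
    using A B by (simp add: extend_id_def)
qed

lemma extend_id_one: "extend_id k (1\<^sub>m m) = 1\<^sub>m (m + k)"
  by (simp add: extend_id_def)

lemma extend_id_gl: "P \<in> gl m \<Longrightarrow> extend_id k P \<in> gl (m + k)" for P :: "'a::field mat"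
  using det_four_block_mat_upper_right_zero[of P m "0\<^sub>m m k" k "0\<^sub>m k m" "1\<^sub>m k"]
  by (auto simp: gl_def extend_id_def)

text \<open>If \<open>A\<close> inverts \<open>P\<close> up to a nonzero factor, as far as the rows outside \<open>S\<close> are concerned,
  then these rows are equations for the span of the columns in \<open>S\<close>.\<close>

lemma colspan_as_kernel:
  assumes P: "P \<in> gl n" and A: "A \<in> carrier_mat n n" and c: "c \<noteq> 0"
    and AP: "\<And>l b. l < n \<Longrightarrow> l \<notin> S \<Longrightarrow> b < n \<Longrightarrow> (A * P) $$ (l, b) = (if l = b then c else 0)"
  shows "colspan n P S = {v \<in> carrier_vec n. \<forall>l<n. l \<notin> S \<longrightarrow> (A *\<^sub>v v) $ l = 0}"
proof -
  have Pc: "P \<in> carrier_mat n n" using P by (simp add: gl_def)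
  have row: "(A *\<^sub>v (P *\<^sub>v u)) $ l = c * u $ l" if u: "u \<in> carrier_vec n" and l: "l < n" "l \<notin> S" for u l
  proof -
    define M where "M = A * P"
    have M: "M \<in> carrier_mat n n" unfolding M_def using A Pc by (rule mult_carrier_mat)
    have "A *\<^sub>v (P *\<^sub>v u) = M *\<^sub>v u"
      using A Pc u by (simp add: M_def assoc_mult_mat_vec[of _ n n _ n])
    also have "\<dots> $ l = (\<Sum>b = 0..<n. M $$ (l, b) * u $ b)"
      using M u l by (auto simp: scalar_prod_def intro!: sum.cong)
    also have "\<dots> = (\<Sum>b = 0..<n. if b = l then c * u $ l else 0)"
      using AP[OF l] by (intro sum.cong) (auto simp: M_def)
    finally show ?thesis using l by simp
  qed
  show ?thesis
  proof (intro equalityI subsetI)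
    fix v assume "v \<in> colspan n P S"
    then obtain u where u: "u \<in> coord_space n S" "v = P *\<^sub>v u" by (auto simp: colspan_def)
    then show "v \<in> {v \<in> carrier_vec n. \<forall>l<n. l \<notin> S \<longrightarrow> (A *\<^sub>v v) $ l = 0}"
      using row[of u] Pc by (auto simp: coord_space_def)
  next
    fix v assume v: "v \<in> {v \<in> carrier_vec n. \<forall>l<n. l \<notin> S \<longrightarrow> (A *\<^sub>v v) $ l = 0}"
    obtain P' where P': "P' \<in> gl n" "P * P' = 1\<^sub>m n" using gl_inverse[OF P] by blast
    define u where "u = P' *\<^sub>v v"
    have P'c: "P' \<in> carrier_mat n n" using P' by (simp add: gl_def)
    have uc: "u \<in> carrier_vec n" using v P'c by (auto simp: u_def)
    have vu: "v = P *\<^sub>v u"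
      using v P'(2) Pc P'c by (simp add: u_def assoc_mult_mat_vec[of _ n n _ n, symmetric])
    have "u \<in> coord_space n S"
      using row[OF uc] v c uc by (auto simp: coord_space_def vu)
    then show "v \<in> colspan n P S"
      unfolding colspan_def vu by (rule imageI)
  qed
qed

lemma colspan_cong_cols:
  assumes P: "P \<in> carrier_mat n n" and Q: "Q \<in> carrier_mat n n"
    and eq: "\<And>a l. a < n \<Longrightarrow> l < n \<Longrightarrow> l \<in> S \<Longrightarrow> P $$ (a, l) = Q $$ (a, l)"
  shows "colspan n P S = colspan n Q S"
proof -
  have "P *\<^sub>v x = Q *\<^sub>v x" if x: "x \<in> coord_space n S" for x
  proof (rule eq_vecI)
    fix a assume "a < dim_vec (Q *\<^sub>v x)"
    then have a: "a < n" using Q by simp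
    have "P $$ (a, l) * x $ l = Q $$ (a, l) * x $ l" if "l < n" for l
      using eq[OF a that] x that by (cases "l \<in> S") (auto simp: coord_space_def)
    then show "(P *\<^sub>v x) $ a = (Q *\<^sub>v x) $ a"
      using P Q a x by (auto simp: scalar_prod_def coord_space_def intro!: sum.cong)
  qed (use P Q in auto)
  then show ?thesis unfolding colspan_def by (rule image_cong[OF refl])
qed

text \<open>Indices below \<open>r\<close> belong to the \<open>A\<^sub>i\<close>, the others to the \<open>B\<^sub>j\<close>. The functions
  \<open>\<alpha>\<close> and \<open>\<beta>\<close> assign the first \<open>m\<close> coordinates to blocks: to the columns that span \<open>A\<^sub>i\<close> and to the
  equations that define \<open>B\<^sub>j\<close>, respectively.

  The first \<open>m\<close> columns of \<open>h\<close> contain the spanning columns of all the \<open>A\<^sub>i\<close>, and the last \<open>k\<close> columns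
  span a subspace of the common kernel of the equations of all the \<open>B\<^sub>j\<close>. Adjugates in place of
  inverses keep all entries polynomial in the parameter.\<close>

lemma generic_configuration:
  fixes Q :: "nat \<Rightarrow> 'a::field mat"
  assumes Q: "\<And>i. i < N \<Longrightarrow> Q i \<in> gl (m + k)"
    and SA: "\<And>i. i < r \<Longrightarrow> S i = {l. l < m \<and> \<alpha> l = i}"
    and SB: "\<And>i. r \<le> i \<Longrightarrow> i < N \<Longrightarrow> S i = {..<m + k} - {l. l < m \<and> \<beta> l = i}"
  obtains q :: "'a poly" and X :: "nat \<Rightarrow> 'a poly mat" where
    "q \<noteq> 0" "\<And>i. X i \<in> carrier_mat (m + k) (m + k)"
    "\<And>i. i < N \<Longrightarrow> eval_mat 0 (X i) = Q i"
    "\<And>t. poly q t \<noteq> 0 \<Longrightarrow> \<exists>h \<in> gl (m + k). \<exists>P. \<forall>i<N. P i \<in> gl m \<and>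
       colspan (m + k) (eval_mat t (X i)) (S i) = colspan (m + k) (h * extend_id k (P i)) (S i)"
proof -
  define n where "n = m + k"
  define Q' where "Q' i = (if i < N then Q i else 1\<^sub>m n)" for i
  have Q': "Q' i \<in> carrier_mat n n" for i
    using Q by (auto simp: Q'_def gl_def n_def)
  \<comment> \<open>The line from \<open>Q' i\<close> at parameter \<open>0\<close> to the identity at parameter \<open>1\<close>.\<close>
  define X where "X i = mat n n (\<lambda>(a, b). [:Q' i $$ (a, b), (if a = b then 1 else 0) - Q' i $$ (a, b):])" for i
  have X: "X i \<in> carrier_mat n n" for i by (simp add: X_def)
  have X0: "eval_mat 0 (X i) = Q' i" for i
    using Q'[of i] by (intro eq_matI) (auto simp: X_def)
  have X1: "eval_mat 1 (X i) = 1\<^sub>m n" for i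
    by (intro eq_matI) (auto simp: X_def)
  define Y where "Y i = adj_mat (X i)" for i
  have Y: "Y i \<in> carrier_mat n n" for i using adj_mat(1)[OF X] by (simp add: Y_def)
  have Y1: "eval_mat 1 (Y i) = 1\<^sub>m n" for i
    using eval_mat_adj_mat_one[OF X X1] by (simp add: Y_def)
  have ev1: "poly (Z $$ (a, b)) 1 = (if a = b then 1 else 0)"
    if "eval_mat 1 Z = 1\<^sub>m n" "Z \<in> carrier_mat n n" "a < n" "b < n" for Z :: "'a poly mat" and a b
  proof -
    have "poly (Z $$ (a, b)) 1 = eval_mat 1 Z $$ (a, b)" using that(2-4) by simp
    also have "\<dots> = (if a = b then 1 else 0)" unfolding that(1) using that(3,4) by simp
    finally show ?thesis .
  qed
  \<comment> \<open>The first \<open>m\<close> rows contain the equations of all the subspaces of the second kind; they annihilate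
    the last \<open>k\<close> columns of the adjugate \<open>D\<close>.\<close>
  define C where "C = mat n n (\<lambda>(l, b). if l < m then Y (\<beta> l) $$ (l, b) else if l = b then 1 else 0)"
  have C: "C \<in> carrier_mat n n" by (simp add: C_def)
  have C1: "eval_mat 1 C = 1\<^sub>m n"
    by (intro eq_matI) (auto simp: C_def ev1[OF Y1 Y])
  define D where "D = adj_mat C"
  have D: "D \<in> carrier_mat n n" using adj_mat(1)[OF C] by (simp add: D_def)
  have D1: "eval_mat 1 D = 1\<^sub>m n"
    using eval_mat_adj_mat_one[OF C C1] by (simp add: D_def)
  define H where "H = mat n n (\<lambda>(a, l). if l < m then X (\<alpha> l) $$ (a, l) else D $$ (a, l))"
  have H: "H \<in> carrier_mat n n" by (simp add: H_def)
  have H1: "eval_mat 1 H = 1\<^sub>m n"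
    by (intro eq_matI) (auto simp: H_def ev1[OF X1 X] ev1[OF D1 D])
  define Z where "Z i = Y i * H" for i
  have Z: "Z i \<in> carrier_mat n n" for i
    unfolding Z_def using Y H by (rule mult_carrier_mat)
  have Z1: "eval_mat 1 (Z i) = 1\<^sub>m n" for i
    using eval_mat_mult[OF Y H] by (simp add: Z_def Y1 H1)
  have Z0: "Z i $$ (l, b) = 0" if "l < m" "\<beta> l = i" "m \<le> b" "b < n" for i l b
  proof -
    have "Z i $$ (l, b) = (\<Sum>a = 0..<n. Y i $$ (l, a) * H $$ (a, b))"
      using that Y[of i] H by (auto simp: Z_def scalar_prod_def intro!: sum.cong)
    also have "\<dots> = (\<Sum>a = 0..<n. C $$ (l, a) * D $$ (a, b))"
      using that by (intro sum.cong) (auto simp: H_def C_def)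
    also have "\<dots> = (C * D) $$ (l, b)"
      using that C D by (auto simp: scalar_prod_def intro!: sum.cong)
    also have "\<dots> = 0"
      using adj_mat(2)[OF C] that by (simp add: D_def)
    finally show ?thesis .
  qed
  \<comment> \<open>The equations of the \<open>i\<close>-th subspace in the basis given by the columns of \<open>H\<close>. By \<open>Z0\<close> they do not
    involve the last \<open>k\<close> coordinates. The remaining rows only make the matrix square, and the
    inverse of \<open>R i\<close> is then a matrix for the small subspace.\<close>
  define R where "R i = mat m m (\<lambda>(l, b). if \<beta> l = i then Z i $$ (l, b) else if l = b then 1 else 0)" for i
  have R: "R i \<in> carrier_mat m m" for i by (simp add: R_def)
  have R1: "eval_mat 1 (R i) = 1\<^sub>m m" for i
    by (intro eq_matI) (auto simp: R_def ev1[OF Z1 Z] n_def)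
  define q where "q = det H * (\<Prod>i<N. det (X i) * det (R i))"
  have "poly q 1 = 1"
    by (simp add: q_def poly_prod det_eval_mat[symmetric] H1 X1 R1)
  then have q: "q \<noteq> 0" by auto
  have gen: "\<exists>h \<in> gl n. \<exists>P. \<forall>i<N. P i \<in> gl m \<and>
       colspan n (eval_mat t (X i)) (S i) = colspan n (h * extend_id k (P i)) (S i)"
    if t: "poly q t \<noteq> 0" for t
  proof -
    define h where "h = eval_mat t H"
    have h: "h \<in> gl n"
      using t H by (simp add: gl_def h_def det_eval_mat q_def)
    have hc: "h \<in> carrier_mat n n" using h by (simp add: gl_def)
    have "\<exists>P \<in> gl m. colspan n (eval_mat t (X i)) (S i) = colspan n (h * extend_id k P) (S i)"
      if i: "i < N" for i
    proof (cases "i < r")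
      case True
      have "colspan n (eval_mat t (X i)) (S i) = colspan n h (S i)"
        by (rule colspan_cong_cols)
          (use X[of i] H hc SA[OF True] in \<open>auto simp: h_def H_def\<close>)
      also have "h = h * extend_id k (1\<^sub>m m)"
        using hc by (simp add: extend_id_one n_def)
      finally show ?thesis
        by (intro bexI[of _ "1\<^sub>m m"]) (simp_all add: gl_def)
    next
      case False
      then have S: "S i = {..<n} - {l. l < m \<and> \<beta> l = i}" using SB i by (simp add: n_def)
      have nz: "poly (det (X i)) t \<noteq> 0" "poly (det (R i)) t \<noteq> 0"
        using t i by (auto simp: q_def poly_prod)
      define x where "x = eval_mat t (X i)"
      define y where "y = eval_mat t (Y i)"
      define \<rho> where "\<rho> = eval_mat t (R i)"
      have x: "x \<in> gl n" and yc: "y \<in> carrier_mat n n" and \<rho>: "\<rho> \<in> gl m"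
        using X[of i] Y[of i] R[of i] nz by (simp_all add: x_def y_def \<rho>_def gl_def det_eval_mat)
      obtain \<rho>' where \<rho>': "\<rho>' \<in> gl m" "\<rho> * \<rho>' = 1\<^sub>m m" using gl_inverse[OF \<rho>] by blast
      have \<rho>c: "\<rho> \<in> carrier_mat m m" "\<rho>' \<in> carrier_mat m m" using \<rho> \<rho>' by (auto simp: gl_def)
      have Ec: "extend_id k \<rho>' \<in> carrier_mat n n" "extend_id k \<rho> \<in> carrier_mat n n"
        using \<rho>c by (simp_all add: n_def)
      define w where "w = eval_mat t (Z i)"
      have wc: "w \<in> carrier_mat n n" using Z by (simp add: w_def)
      have yh: "y * h = w"
        using eval_mat_mult[OF Y H] by (simp add: Z_def w_def y_def h_def)
      have ext: "extend_id k \<rho> * extend_id k \<rho>' = 1\<^sub>m n"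
        using extend_id_mult[OF \<rho>c, of k] by (simp add: \<rho>'(2) extend_id_one n_def)
      have T: "l < m" "\<beta> l = i" if "l < n" "l \<notin> S i" for l
        using that by (auto simp: S)
      have "colspan n x (S i) = {v \<in> carrier_vec n. \<forall>l<n. l \<notin> S i \<longrightarrow> (y *\<^sub>v v) $ l = 0}"
      proof (rule colspan_as_kernel[OF x yc nz(1)])
        have "y * x = poly (det (X i)) t \<cdot>\<^sub>m 1\<^sub>m n"
          using eval_mat_mult[OF Y X, of t i i] adj_mat(3)[OF X[of i]]
          by (simp add: x_def y_def Y_def eval_mat_smult_one)
        then show "(y * x) $$ (l, b) = (if l = b then poly (det (X i)) t else 0)" if "l < n" "b < n" for l b
          using that by simp
      qed
      also have "\<dots> = colspan n (h * extend_id k \<rho>') (S i)"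
      proof (rule colspan_as_kernel[symmetric, where c = 1])
        show "h * extend_id k \<rho>' \<in> gl n"
          using gl_mult[OF h] extend_id_gl[OF \<rho>'(1), of k] by (simp add: n_def)
        fix l b assume lb: "l < n" "l \<notin> S i" "b < n"
        have row: "w $$ (l, a) = extend_id k \<rho> $$ (l, a)" if a: "a < n" for a
          using T[OF lb(1,2)] a Z0[of l i a] Z[of i] R[of i] index_extend_id[OF \<rho>c(1), of l k a]
          by (auto simp: w_def \<rho>_def R_def n_def)
        have "(y * (h * extend_id k \<rho>')) $$ (l, b) = (w * extend_id k \<rho>') $$ (l, b)"
          using yc hc Ec by (simp add: yh[symmetric] assoc_mult_mat[of _ n n _ n _ n])
        also have "\<dots> = (\<Sum>a = 0..<n. w $$ (l, a) * extend_id k \<rho>' $$ (a, b))"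
          using lb wc Ec by (auto simp: scalar_prod_def intro!: sum.cong)
        also have "\<dots> = (\<Sum>a = 0..<n. extend_id k \<rho> $$ (l, a) * extend_id k \<rho>' $$ (a, b))"
          using row by (intro sum.cong) auto
        also have "\<dots> = (extend_id k \<rho> * extend_id k \<rho>') $$ (l, b)"
          using lb Ec by (auto simp: scalar_prod_def intro!: sum.cong)
        also have "\<dots> = (if l = b then 1 else 0)"
          unfolding ext using lb by simp
        finally show "(y * (h * extend_id k \<rho>')) $$ (l, b) = (if l = b then 1 else 0)" .
      qed (use yc in auto)
      finally show ?thesis using \<rho>'(1) unfolding x_def by blast
    qed
    then have "\<forall>i<N. \<exists>P. P \<in> gl m \<and> colspan n (eval_mat t (X i)) (S i) = colspan n (h * extend_id k P) (S i)"
      by blast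
    then show ?thesis using h by metis
  qed
  show thesis
    by (rule that[of q X]) (use q X X0 gen in \<open>auto simp: Q'_def n_def\<close>)
qed

text \<open>Coordinates that no block uses receive a value that is not an index of \<open>cs\<close>.\<close>

lemma block_assignment:
  assumes "sum_list cs \<le> m"
  shows "\<exists>\<alpha>. \<forall>i<length cs. card {l. l < m \<and> \<alpha> l = i} = cs ! i"
  using assms
proof (induction cs arbitrary: m)
  case (Cons c cs)
  then have "sum_list cs \<le> m - c" by simp
  from Cons.IH[OF this] obtain \<alpha> where
    \<alpha>: "\<forall>i<length cs. card {l. l < m - c \<and> \<alpha> l = i} = cs ! i" ..
  define \<alpha>' where "\<alpha>' l = (if l < m - c then Suc (\<alpha> l) else 0)" for l
  have "{l. l < m \<and> \<alpha>' l = 0} = {m - c..<m}" by (auto simp: \<alpha>'_def)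
  then have "card {l. l < m \<and> \<alpha>' l = 0} = c" using Cons.prems by simp
  moreover have "{l. l < m \<and> \<alpha>' l = Suc i} = {l. l < m - c \<and> \<alpha> l = i}" for i
    by (auto simp: \<alpha>'_def)
  ultimately have "\<forall>i<length (c # cs). card {l. l < m \<and> \<alpha>' l = i} = (c # cs) ! i"
    using \<alpha> by (auto simp: nth_Cons split: nat.split)
  then show ?case by blast
qed simp

section \<open>Density of the larger dimension vector\<close>

theorem lemma4p2:
  fixes as bs :: "nat list" and n k :: nat
  assumes "as \<noteq> []" and "bs \<noteq> []"
    and "dimension_vector (as @ bs) n"
    and "sum_list as = n - k" and "n - k < n"
    and "(\<Sum>b\<leftarrow>bs. n - b) \<le> n - k"
    and "dense TYPE('a::alg_closed_field) (as @ map (\<lambda>b. b - k) bs) (n - k)"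
  shows "dense TYPE('a) (as @ bs) n"
proof -
  define m where "m = n - k"
  have "hd as \<in> set as" using assms(1) by simp
  then have "1 \<le> hd as" "hd as \<le> sum_list as"
    using assms(3) member_le_sum_list[of "hd as" as] by (auto simp: dimension_vector_def)
  then have n: "n = m + k" using assms(4) by (simp add: m_def)
  define r where "r = length as"
  define ds where "ds = as @ bs"
  define ds' where "ds' = as @ map (\<lambda>b. b - k) bs"
  define N where "N = length ds"
  have N: "length ds = N" "length ds' = N" "r \<le> N" "N - r = length bs"
    by (simp_all add: N_def ds_def ds'_def r_def)
  obtain \<alpha> where \<alpha>: "\<And>i. i < r \<Longrightarrow> card {l. l < m \<and> \<alpha> l = i} = as ! i"
    using block_assignment[of as m] assms(4) by (auto simp: r_def m_def)
  obtain \<beta>0 where \<beta>0: "\<And>j. j < length bs \<Longrightarrow> card {l. l < m \<and> \<beta>0 l = j} = n - bs ! j"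
    using block_assignment[of "map (\<lambda>b. n - b) bs" m] assms(6) by (auto simp: m_def)
  \<comment> \<open>Shifted to match the position of the \<open>B\<^sub>j\<close> in the list.\<close>
  define \<beta> where "\<beta> l = r + \<beta>0 l" for l
  have \<beta>: "card {l. l < m \<and> \<beta> l = i} = n - ds ! i" if "r \<le> i" "i < N" for i
  proof -
    have "{l. l < m \<and> \<beta> l = i} = {l. l < m \<and> \<beta>0 l = i - r}" using that by (auto simp: \<beta>_def)
    then show ?thesis using \<beta>0[of "i - r"] that N by (simp add: ds_def nth_append r_def)
  qed
  define S where "S i = (if i < r then {l. l < m \<and> \<alpha> l = i} else {..<m + k} - {l. l < m \<and> \<beta> l = i})" for i
  have dsn: "ds ! i < n" if "i < N" for i
    using assms(3) that N(1) by (auto simp: dimension_vector_def ds_def[symmetric])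
  have S: "coord_sets ds n S"
    unfolding coord_sets_def N(1)
  proof (intro allI impI)
    fix i assume i: "i < N"
    show "S i \<subseteq> {..<n} \<and> card (S i) = ds ! i"
    proof (cases "i < r")
      case True
      then show ?thesis using \<alpha>[OF True] by (auto simp: S_def n ds_def nth_append r_def)
    next
      case False
      have "card (S i) = n - (n - ds ! i)"
        using False \<beta>[of i] i unfolding S_def by (simp add: n card_Diff_subset subset_iff)
      then show ?thesis using dsn[OF i] False by (auto simp: S_def n)
    qed
  qed
  have S': "coord_sets ds' m (\<lambda>i. S i \<inter> {..<m})"
    unfolding coord_sets_def N(2)
  proof (intro allI impI)
    fix i assume i: "i < N"
    show "S i \<inter> {..<m} \<subseteq> {..<m} \<and> card (S i \<inter> {..<m}) = ds' ! i"
    proof (cases "i < r")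
      case True
      then have "S i \<inter> {..<m} = {l. l < m \<and> \<alpha> l = i}" by (auto simp: S_def)
      then show ?thesis using \<alpha>[OF True] True by (auto simp: ds'_def nth_append r_def)
    next
      case False
      have "S i \<inter> {..<m} = {..<m} - {l. l < m \<and> \<beta> l = i}" using False by (auto simp: S_def)
      then have "card (S i \<inter> {..<m}) = m - (n - ds ! i)"
        using False \<beta>[of i] i by (simp add: card_Diff_subset subset_iff)
      moreover have "n - ds ! i \<le> m"
        using \<beta>[of i] False i card_mono[of "{..<m}" "{l. l < m \<and> \<beta> l = i}"] by (auto simp: subset_iff)
      moreover have "ds' ! i = ds ! i - k"
        using False i N by (simp add: ds'_def ds_def nth_append r_def)
      ultimately show ?thesis using dsn[OF i] n by auto
    qed
  qed
  have "dense TYPE('a) ds' m" using assms(7) by (simp add: ds'_def m_def)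
  then obtain P :: "nat \<Rightarrow> 'a mat" where P: "\<And>i. i < N \<Longrightarrow> P i \<in> gl m"
    and dP: "\<And>p Q. multihomogeneous ds' m p \<Longrightarrow>
      \<forall>g \<in> gl m. minor_eval (\<lambda>i. S i \<inter> {..<m}) (\<lambda>i. g * P i) p = 0 \<Longrightarrow>
      \<forall>i<N. Q i \<in> gl m \<Longrightarrow> minor_eval (\<lambda>i. S i \<inter> {..<m}) Q p = 0"
    unfolding dense_iff_minor_eval[OF S'] N(2) by blast
  have "minor_eval S Q p = 0"
    if p: "multihomogeneous ds n p"
      and van: "\<forall>g \<in> gl n. minor_eval S (\<lambda>i. g * extend_id k (P i)) p = 0"
      and Q: "\<forall>i<N. Q i \<in> gl n" for p :: "'a mpoly" and Q
  proof -
    \<comment> \<open>The polynomial vanishes at every configuration that splits, because the small dimension vector is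
      dense: left multiplication of the small matrices by \<open>g\<close> is left multiplication of
      the enlarged ones by \<open>extend_id k g\<close>.\<close>
    have block: "minor_eval S (\<lambda>i. h * extend_id k (P' i)) p = 0"
      if h: "h \<in> gl n" and P': "\<forall>i<N. P' i \<in> gl m" for h P'
    proof -
      have hc: "h \<in> carrier_mat (m + k) (m + k)" using h by (simp add: gl_def n)
      obtain p' where p': "multihomogeneous ds' m p'"
        and ev: "\<And>P. \<forall>i<N. P i \<in> carrier_mat m m \<Longrightarrow>
          minor_eval (\<lambda>i. S i \<inter> {..<m}) P p' = minor_eval S (\<lambda>i. h * extend_id k (P i)) p"
        using minor_eval_mult_extend_id[OF S[unfolded n] S' _ hc p[unfolded n]] N by auto
      have van': "\<forall>g \<in> gl m. minor_eval (\<lambda>i. S i \<inter> {..<m}) (\<lambda>i. g * P i) p' = 0"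
      proof
        fix g :: "'a mat" assume g: "g \<in> gl m"
        have gc: "g \<in> carrier_mat m m" and Pc: "\<And>i. i < N \<Longrightarrow> P i \<in> carrier_mat m m"
          using g P by (auto simp: gl_def)
        have "minor_eval (\<lambda>i. S i \<inter> {..<m}) (\<lambda>i. g * P i) p' = minor_eval S (\<lambda>i. h * extend_id k (g * P i)) p"
          using gc Pc by (intro ev) auto
        also have "\<dots> = minor_eval S (\<lambda>i. (h * extend_id k g) * extend_id k (P i)) p"
          unfolding minor_eval_def
        proof (rule poly_eval_cong[OF p], clarsimp)
          fix i I assume "(i, I) \<in> pluecker_vars ds n"
          then have "i < N" by (simp add: pluecker_vars_def N(1))
          then show "minor (h * extend_id k (g * P i)) I (S i) = minor (h * extend_id k g * extend_id k (P i)) I (S i)"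
            using extend_id_mult[OF gc Pc, of i k] hc gc Pc[of i]
            by (simp add: assoc_mult_mat[of _ "m + k" "m + k" _ "m + k" _ "m + k"])
        qed
        also have "\<dots> = 0"
          using van gl_mult[OF h[unfolded n] extend_id_gl[OF g, of k]] by (simp add: n)
        finally show "minor_eval (\<lambda>i. S i \<inter> {..<m}) (\<lambda>i. g * P i) p' = 0" .
      qed
      have "minor_eval (\<lambda>i. S i \<inter> {..<m}) P' p' = 0"
        by (rule dP[OF p' van' P'])
      then show ?thesis using ev[of P'] P' by (simp add: gl_def)
    qed
    have SA: "S i = {l. l < m \<and> \<alpha> l = i}" if "i < r" for i using that by (simp add: S_def)
    have SB: "S i = {..<m + k} - {l. l < m \<and> \<beta> l = i}" if "r \<le> i" "i < N" for i
      using that by (simp add: S_def)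
    have Q': "Q i \<in> gl (m + k)" if "i < N" for i using Q that n by simp
    show ?thesis
    proof (rule generic_configuration[OF Q' SA SB])
      fix q :: "'a poly" and X :: "nat \<Rightarrow> 'a poly mat"
      assume q: "q \<noteq> 0"
        and X: "\<And>i. X i \<in> carrier_mat (m + k) (m + k)" "\<And>i. i < N \<Longrightarrow> eval_mat 0 (X i) = Q i"
        and gen: "\<And>t. poly q t \<noteq> 0 \<Longrightarrow> \<exists>h \<in> gl (m + k). \<exists>P. \<forall>i<N. P i \<in> gl m \<and>
          colspan (m + k) (eval_mat t (X i)) (S i) = colspan (m + k) (h * extend_id k (P i)) (S i)"
      have Xc: "X i \<in> carrier_mat n n" for i using X(1) by (simp add: n)
      have "minor_eval S (\<lambda>i. eval_mat 0 (X i)) p = 0"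
      proof (rule minor_eval_eq_0_if_generically_0[OF infinite_alg_closed p S Xc q])
        fix t assume "poly q t \<noteq> 0"
        from gen[OF this] obtain h P' where h: "h \<in> gl n" and P': "\<forall>i<N. P' i \<in> gl m"
          and eq: "\<And>i. i < N \<Longrightarrow> colspan n (eval_mat t (X i)) (S i) = colspan n (h * extend_id k (P' i)) (S i)"
          unfolding n by blast
        let ?Ws = "config N n S (\<lambda>i. eval_mat t (X i))"
        have "minor_eval S (\<lambda>i. h * extend_id k (P' i)) p = 0" using block[OF h P'] .
        then have "pluecker_eval ds n ?Ws p = 0"
          using h P' eq by (subst pluecker_eval_colspan[OF p S, of "\<lambda>i. h * extend_id k (P' i)"])
            (auto simp: N(1) config_def gl_def n)
        then show "minor_eval S (\<lambda>i. eval_mat t (X i)) p = 0"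
          using Xc by (subst (asm) pluecker_eval_colspan[OF p S, of "\<lambda>i. eval_mat t (X i)"])
            (auto simp: N(1) config_def)
      qed
      moreover have "minor_eval S (\<lambda>i. eval_mat 0 (X i)) p = minor_eval S Q p"
        unfolding minor_eval_def
        by (rule poly_eval_cong[OF p]) (auto simp: pluecker_vars_def N(1) X(2))
      ultimately show ?thesis by simp
    qed
  qed
  moreover have "\<forall>i<N. extend_id k (P i) \<in> gl n"
    using extend_id_gl[OF P] by (simp add: n)
  ultimately have "dense TYPE('a) ds n"
    unfolding dense_iff_minor_eval[OF S] N(1) by (intro exI[of _ "\<lambda>i. extend_id k (P i)"]) auto
  then show ?thesis by (simp add: ds_def)
qed

end
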